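(* Let $F:(M^m,g_M)\to(N^n,g_N)$ be a Riemannian map between Riemannian manifolds such that the distribution $(range F_\ast)^\bot$ is totally geodesic. Let $\{F_\ast X_j\}_{r+1\le j\le m}$ and $\{e_k\}_{1\le k\le n_1}$ be orthonormal bases of $range F_\ast$ and $(range F_\ast)^\bot$, respectively, and let $s^N$, $s^{range F_\ast}$, $s^{(range F_\ast)^\bot}$ denote the scalar curvatures of $N$, $range F_\ast$ and $(range F_\ast)^\bot$. Then $$\begin{aligned}s^N=&\,s^{range F_\ast}+s^{(range F_\ast)^\bot}-2\sum_{j=r+1}^m\sum_{k=1}^{n_1}g_N(\mathcal{S}_{\nabla^{F\bot}_{e_k}e_k}F_\ast X_j,F_\ast X_j)+\sum_{j=r+1}^m\sum_{k=1}^{n_1}g_N(\nabla^N_{e_k}\mathcal{S}_{e_k}F_\ast X_j,F_\ast X_j)\\&-2\sum_{j=r+1}^m\sum_{k=1}^{n_1}g_N(\mathcal{S}_{e_k}F_\ast X_j,\mathcal{S}_{e_k}F_\ast X_j)-3\sum_{j=r+1}^m\sum_{k=1}^{n_1}g_N(\nabla^N_{e_k}F_\ast X_j,\mathcal{S}_{e_k}F_\ast X_j)\\&+\sum_{j=r+1}^m\sum_{k=1}^{n_1}\nabla^N_{e_k}\big(g_N(\mathcal{S}_{e_k}F_\ast X_j,F_\ast X_j)\big).\end{aligned}$$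
   Context: A smooth map $F:(M^m,g_M)\to(N^n,g_N)$ with $0<rank F\le\min\{m,n\}$ is a Riemannian map if at each $p\in M$ the restriction of $F_{\ast p}$ to $(\ker F_{\ast p})^\bot$ is a linear isometry onto $range F_{\ast p}$. $r=\dim\ker F_\ast$, $m-r=rank F$, $n_1=\dim(range F_\ast)^\bot$, and $X_j\in\Gamma(\ker F_\ast)^\bot$. $(range F_\ast)^\bot$ is the orthogonal complement of $range F_\ast$ in $TN$; following the paper, $range F_\ast$ and $(range F_\ast)^\bot$ are regarded as complementary orthogonal distributions (subbundles of $TN$) on $N$. $\nabla^N$ is the Levi-Civita connection of $N$, $R^N(X_1,Y_1)Z_1=\nabla^N_{X_1}\nabla^N_{Y_1}Z_1-\nabla^N_{Y_1}\nabla^N_{X_1}Z_1-\nabla^N_{[X_1,Y_1]}Z_1$, $Ric(X_1,Y_1)=trace(Z_1\mapsto R^N(Z_1,X_1)Y_1)$, and $s^N$ is the trace of $Ric$. For a function $h$, $\nabla^N_Vh=V(h)$. For $X\in\Gamma(TM)$ and $V\in\Gamma(range F_\ast)^\bot$, $\mathcal{S}_VF_\ast X\in\Gamma(range F_\ast)$ and $\nabla_X^{F\bot}V\in\Gamma(range F_\ast)^\bot$ are defined by $\nabla^N_{F_\ast X}V=-\mathcal{S}_VF_\ast X+\nabla^{F\bot}_XV$. For $U,V\in\Gamma(range F_\ast)^\bot$, $\nabla_U^{F\bot}V$ is the component of $\nabla^N_UV$ in $(range F_\ast)^\bot$; the distribution $(range F_\ast)^\bot$ is totally geodesic if $\nabla^N_UV=\nabla^{F\bot}_UV$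 for all such $U,V$. As used in the paper, $Ric^{range F_\ast}(F_\ast X,F_\ast Y)=\sum_{j=r+1}^mg_N(R^N(F_\ast X_j,F_\ast X)F_\ast Y,F_\ast X_j)$ and $Ric^{(range F_\ast)^\bot}(V,W)=\sum_{k=1}^{n_1}g_N(R^N(e_k,V)W,e_k)$, and $s^{range F_\ast}=\sum_jRic^{range F_\ast}(F_\ast X_j,F_\ast X_j)$, $s^{(range F_\ast)^\bot}=\sum_kRic^{(range F_\ast)^\bot}(e_k,e_k)$. *)

theory Defs
  imports "HOL-Analysis.Analysis" "HOL-Library.Function_Algebras"
begin

section \<open>Smooth manifolds\<close>

primrec ck_on :: "nat \<Rightarrow> 'e::real_normed_vector set \<Rightarrow> ('e \<Rightarrow> 'f::real_normed_vector) \<Rightarrow> bool" where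
  "ck_on 0 S f \<longleftrightarrow> continuous_on S f"
| "ck_on (Suc k) S f \<longleftrightarrow> (\<forall>x\<in>S. f differentiable (at x)) \<and>
     (\<forall>v. ck_on k S (\<lambda>x. frechet_derivative f (at x) v))"

text \<open>Only meant for open sets \<open>S\<close>.\<close>

definition cinf_on :: "'e::real_normed_vector set \<Rightarrow> ('e \<Rightarrow> 'f::real_normed_vector) \<Rightarrow> bool" where
  "cinf_on S f \<longleftrightarrow> (\<forall>k. ck_on k S f)"

text \<open>
  A manifold is a whole type (Hausdorff and second countable through its type classes) together
  with a smooth atlas, given as a set of charts (domain, coordinate map). The dimension is that of
  the model space \<open>'e\<close>. The atlas need not be maximal: all notions below only depend on the smooth
  structure it generates.
\<close>

type_synonym ('a, 'e) atlas = "('a set \<times> ('a \<Rightarrow> 'e)) set"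

definition smooth_atlas :: "('a::{t2_space,second_countable_topology}, 'e::euclidean_space) atlas \<Rightarrow> bool" where
  "smooth_atlas A \<longleftrightarrow>
     (\<forall>(U, \<phi>)\<in>A. open U \<and> open (\<phi> ` U) \<and> homeomorphism U (\<phi> ` U) \<phi> (inv_into U \<phi>)) \<and>
     (\<Union>(U, \<phi>)\<in>A. U) = UNIV \<and>
     (\<forall>(U, \<phi>)\<in>A. \<forall>(V, \<psi>)\<in>A. cinf_on (\<phi> ` (U \<inter> V)) (\<psi> \<circ> inv_into U \<phi>))"

text \<open>\<open>smooth_fun A U f\<close>: \<open>f\<close> restricts to a smooth function on the open set \<open>U\<close>.\<close>

definition smooth_fun ::
  "('a::topological_space, 'e::euclidean_space) atlas \<Rightarrow> 'a set \<Rightarrow> ('a \<Rightarrow> real) \<Rightarrow> bool" where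
  "smooth_fun A U f \<longleftrightarrow> (\<forall>(V, \<phi>)\<in>A. cinf_on (\<phi> ` (V \<inter> U)) (f \<circ> inv_into V \<phi>))"

definition smooth_near ::
  "('a::topological_space, 'e::euclidean_space) atlas \<Rightarrow> 'a \<Rightarrow> ('a \<Rightarrow> real) \<Rightarrow> bool" where
  "smooth_near A p f \<longleftrightarrow> (\<exists>U. open U \<and> p \<in> U \<and> smooth_fun A U f)"

definition smooth_map ::
  "('a::topological_space, 'e::euclidean_space) atlas \<Rightarrow>
   ('b::topological_space, 'f::euclidean_space) atlas \<Rightarrow> ('a \<Rightarrow> 'b) \<Rightarrow> bool" where
  "smooth_map A B F \<longleftrightarrow> continuous_on UNIV F \<and>
     (\<forall>(U, \<phi>)\<in>A. \<forall>(V, \<psi>)\<in>B. cinf_on (\<phi> ` (U \<inter> F -` V)) (\<psi> \<circ> F \<circ> inv_into U \<phi>))"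

section \<open>Tangent vectors and vector fields\<close>

text \<open>Pointwise scalar multiplication, so that tangent vectors live in a real vector space.\<close>

instantiation "fun" :: (type, real_vector) real_vector
begin

definition scaleR_fun_def: "c *\<^sub>R f = (\<lambda>x. c *\<^sub>R f x)"

instance
  by standard (auto simp: scaleR_fun_def fun_eq_iff algebra_simps)

end

type_synonym 'a tvec = "('a \<Rightarrow> real) \<Rightarrow> real"
type_synonym 'a vfield = "'a \<Rightarrow> 'a tvec"

text \<open>
  Tangent vectors at \<open>p\<close> are the derivations at \<open>p\<close> of germs of smooth functions. A derivation is
  represented by a function on all real functions, so it is normalised to vanish on functions
  that are not smooth near \<open>p\<close>; this makes the representation unique.
\<close>

definition tangent_space ::
  "('a::topological_space, 'e::euclidean_space) atlas \<Rightarrow> 'a \<Rightarrow> 'a tvec set" where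
  "tangent_space A p = {v.
     (\<forall>f. \<not> smooth_near A p f \<longrightarrow> v f = 0) \<and>
     (\<forall>f h U. smooth_near A p f \<and> open U \<and> p \<in> U \<and> (\<forall>x\<in>U. f x = h x) \<longrightarrow> v f = v h) \<and>
     (\<forall>f h. smooth_near A p f \<and> smooth_near A p h \<longrightarrow>
        v (\<lambda>x. f x + h x) = v f + v h \<and>
        v (\<lambda>x. f x * h x) = f p * v h + h p * v f) \<and>
     (\<forall>f c. smooth_near A p f \<longrightarrow> v (\<lambda>x. c * f x) = c * v f)}"

text \<open>\<open>vector_field A U X\<close>: \<open>X\<close> restricts to a smooth vector field on the open set \<open>U\<close>; its values
  outside \<open>U\<close> are irrelevant.\<close>

definition vector_field ::
  "('a::topological_space, 'e::euclidean_space) atlas \<Rightarrow> 'a set \<Rightarrow> 'a vfield \<Rightarrow> bool" where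
  "vector_field A U X \<longleftrightarrow> (\<forall>p\<in>U. X p \<in> tangent_space A p) \<and>
     (\<forall>V f. open V \<and> V \<subseteq> U \<and> smooth_fun A V f \<longrightarrow> smooth_fun A V (\<lambda>p. X p f))"

definition lie_bracket ::
  "('a::topological_space, 'e::euclidean_space) atlas \<Rightarrow> 'a vfield \<Rightarrow> 'a vfield \<Rightarrow> 'a vfield" where
  "lie_bracket A X Y = (\<lambda>p f. if smooth_near A p f
     then X p (\<lambda>q. Y q f) - Y p (\<lambda>q. X q f) else 0)"

text \<open>The guard only serves the normalisation of tangent vectors at \<open>F p\<close>.\<close>

definition differential ::
  "('b::topological_space, 'f::euclidean_space) atlas \<Rightarrow> ('a \<Rightarrow> 'b) \<Rightarrow> 'a \<Rightarrow> 'a tvec \<Rightarrow> 'b tvec" where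
  "differential B F p v = (\<lambda>f. if smooth_near B (F p) f then v (f \<circ> F) else 0)"

definition ker_diff ::
  "('a::topological_space, 'e::euclidean_space) atlas \<Rightarrow>
   ('b::topological_space, 'f::euclidean_space) atlas \<Rightarrow> ('a \<Rightarrow> 'b) \<Rightarrow> 'a \<Rightarrow> 'a tvec set" where
  "ker_diff A B F p = {v \<in> tangent_space A p. differential B F p v = 0}"

definition range_diff ::
  "('a::topological_space, 'e::euclidean_space) atlas \<Rightarrow>
   ('b::topological_space, 'f::euclidean_space) atlas \<Rightarrow> ('a \<Rightarrow> 'b) \<Rightarrow> 'a \<Rightarrow> 'b tvec set" where
  "range_diff A B F p = differential B F p ` tangent_space A p"

section \<open>Riemannian metrics, connections and curvature\<close>

type_synonym 'a metric = "'a \<Rightarrow> 'a tvec \<Rightarrow> 'a tvec \<Rightarrow> real"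

definition riemannian_metric ::
  "('a::topological_space, 'e::euclidean_space) atlas \<Rightarrow> 'a metric \<Rightarrow> bool" where
  "riemannian_metric A g \<longleftrightarrow>
     (\<forall>p. \<forall>u\<in>tangent_space A p. \<forall>v\<in>tangent_space A p. g p u v = g p v u) \<and>
     (\<forall>p. \<forall>u\<in>tangent_space A p. \<forall>v\<in>tangent_space A p. \<forall>w\<in>tangent_space A p. \<forall>a b.
        g p (a *\<^sub>R u + b *\<^sub>R v) w = a * g p u w + b * g p v w) \<and>
     (\<forall>p. \<forall>u\<in>tangent_space A p. u \<noteq> 0 \<longrightarrow> 0 < g p u u) \<and>
     (\<forall>U X Y. open U \<and> vector_field A U X \<and> vector_field A U Y \<longrightarrow>
        smooth_fun A U (\<lambda>p. g p (X p) (Y p)))"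

definition orth_compl ::
  "('a::topological_space, 'e::euclidean_space) atlas \<Rightarrow> 'a metric \<Rightarrow> 'a \<Rightarrow> 'a tvec set \<Rightarrow> 'a tvec set" where
  "orth_compl A g p T = {v \<in> tangent_space A p. \<forall>w\<in>T. g p v w = 0}"

text \<open>
  An affine connection, acting on local vector fields: \<open>nab X Y\<close> is \<open>\<nabla>\<^sub>X Y\<close>, wherever \<open>X\<close> and \<open>Y\<close> are
  both smooth. The second clause says that \<open>nab\<close> is local (compatible with restriction to
  smaller open sets, insensitive to values elsewhere).
\<close>

definition connection ::
  "('a::topological_space, 'e::euclidean_space) atlas \<Rightarrow> ('a vfield \<Rightarrow> 'a vfield \<Rightarrow> 'a vfield) \<Rightarrow> bool" where
  "connection A nab \<longleftrightarrow> (\<forall>U X Y. open U \<and> vector_field A U X \<and> vector_field A U Y \<longrightarrow>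
     vector_field A U (nab X Y) \<and>
     (\<forall>X' Y'. (\<forall>p\<in>U. X' p = X p \<and> Y' p = Y p) \<longrightarrow> (\<forall>p\<in>U. nab X' Y' p = nab X Y p)) \<and>
     (\<forall>Z. vector_field A U Z \<longrightarrow> (\<forall>p\<in>U.
        nab (X + Z) Y p = nab X Y p + nab Z Y p \<and>
        nab X (Y + Z) p = nab X Y p + nab X Z p)) \<and>
     (\<forall>f. smooth_fun A U f \<longrightarrow> (\<forall>p\<in>U.
        nab (\<lambda>q. f q *\<^sub>R X q) Y p = f p *\<^sub>R nab X Y p \<and>
        nab X (\<lambda>q. f q *\<^sub>R Y q) p = X p f *\<^sub>R Y p + f p *\<^sub>R nab X Y p)))"

definition levi_civita ::
  "('a::topological_space, 'e::euclidean_space) atlas \<Rightarrow> 'a metric \<Rightarrow>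
   ('a vfield \<Rightarrow> 'a vfield \<Rightarrow> 'a vfield) \<Rightarrow> bool" where
  "levi_civita A g nab \<longleftrightarrow> connection A nab \<and>
     (\<forall>U X Y. open U \<and> vector_field A U X \<and> vector_field A U Y \<longrightarrow>
        (\<forall>p\<in>U. nab X Y p - nab Y X p = lie_bracket A X Y p)) \<and>
     (\<forall>U X Y Z. open U \<and> vector_field A U X \<and> vector_field A U Y \<and> vector_field A U Z \<longrightarrow>
        (\<forall>p\<in>U. X p (\<lambda>q. g q (Y q) (Z q)) = g p (nab X Y p) (Z p) + g p (Y p) (nab X Z p)))"

definition curvature ::
  "('a::topological_space, 'e::euclidean_space) atlas \<Rightarrow> ('a vfield \<Rightarrow> 'a vfield \<Rightarrow> 'a vfield) \<Rightarrow>
   'a vfield \<Rightarrow> 'a vfield \<Rightarrow> 'a vfield \<Rightarrow> 'a vfield" where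
  "curvature A nab X Y Z = nab X (nab Y Z) - nab Y (nab X Z) - nab (lie_bracket A X Y) Z"

text \<open>The curvature tensor on tangent vectors at a point: the common value for all local
  extensions to vector fields.\<close>

definition curvature_at ::
  "('a::topological_space, 'e::euclidean_space) atlas \<Rightarrow> ('a vfield \<Rightarrow> 'a vfield \<Rightarrow> 'a vfield) \<Rightarrow>
   'a \<Rightarrow> 'a tvec \<Rightarrow> 'a tvec \<Rightarrow> 'a tvec \<Rightarrow> 'a tvec" where
  "curvature_at A nab p u v w = (THE x. \<forall>U X Y Z. open U \<and> p \<in> U \<and>
     vector_field A U X \<and> vector_field A U Y \<and> vector_field A U Z \<and>
     X p = u \<and> Y p = v \<and> Z p = w \<longrightarrow> curvature A nab X Y Z p = x)"

text \<open>Trace of a linear endomorphism \<open>L\<close> of a finite-dimensional subspace \<open>T\<close>, via an arbitrary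
  basis.\<close>

definition trace_on :: "'v::real_vector set \<Rightarrow> ('v \<Rightarrow> 'v) \<Rightarrow> real" where
  "trace_on T L = (let E = (SOME E. independent E \<and> span E = T)
     in \<Sum>b\<in>E. representation E (L b) b)"

definition ricci ::
  "('a::topological_space, 'e::euclidean_space) atlas \<Rightarrow> ('a vfield \<Rightarrow> 'a vfield \<Rightarrow> 'a vfield) \<Rightarrow>
   'a \<Rightarrow> 'a tvec \<Rightarrow> 'a tvec \<Rightarrow> real" where
  "ricci A nab p u v = trace_on (tangent_space A p) (\<lambda>z. curvature_at A nab p z u v)"

text \<open>The trace of the Ricci tensor with respect to the metric, via an arbitrary orthonormal
  basis.\<close>

definition scalar_curvature ::
  "('a::topological_space, 'e::euclidean_space) atlas \<Rightarrow> 'a metric \<Rightarrow>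
   ('a vfield \<Rightarrow> 'a vfield \<Rightarrow> 'a vfield) \<Rightarrow> 'a \<Rightarrow> real" where
  "scalar_curvature A g nab p =
     (let E = (SOME E. finite E \<and> span E = tangent_space A p \<and>
                 (\<forall>u\<in>E. \<forall>v\<in>E. g p u v = (if u = v then 1 else 0)))
      in \<Sum>b\<in>E. ricci A nab p b b)"

section \<open>Distributions\<close>

definition distribution ::
  "('a::topological_space, 'e::euclidean_space) atlas \<Rightarrow> nat \<Rightarrow> ('a \<Rightarrow> 'a tvec set) \<Rightarrow> bool" where
  "distribution A k D \<longleftrightarrow> (\<forall>p. \<exists>U E. open U \<and> p \<in> U \<and> (\<forall>i<k. vector_field A U (E i)) \<and>
     (\<forall>q\<in>U. inj_on (\<lambda>i. E i q) {..<k} \<and> independent ((\<lambda>i. E i q) ` {..<k}) \<and>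
        span ((\<lambda>i. E i q) ` {..<k}) = D q))"

definition section_of ::
  "('a::topological_space, 'e::euclidean_space) atlas \<Rightarrow> 'a set \<Rightarrow> ('a \<Rightarrow> 'a tvec set) \<Rightarrow> 'a vfield \<Rightarrow> bool" where
  "section_of A U D X \<longleftrightarrow> vector_field A U X \<and> (\<forall>p\<in>U. X p \<in> D p)"

definition perp ::
  "('a::topological_space, 'e::euclidean_space) atlas \<Rightarrow> 'a metric \<Rightarrow> ('a \<Rightarrow> 'a tvec set) \<Rightarrow> 'a \<Rightarrow> 'a tvec set" where
  "perp A g D = (\<lambda>p. orth_compl A g p (D p))"

definition orthonormal_frame ::
  "('a::topological_space, 'e::euclidean_space) atlas \<Rightarrow> 'a metric \<Rightarrow> 'a set \<Rightarrow> ('a \<Rightarrow> 'a tvec set) \<Rightarrow>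
   nat set \<Rightarrow> (nat \<Rightarrow> 'a vfield) \<Rightarrow> bool" where
  "orthonormal_frame A g U D I E \<longleftrightarrow> (\<forall>i\<in>I. vector_field A U (E i)) \<and>
     (\<forall>p\<in>U. span ((\<lambda>i. E i p) ` I) = D p \<and>
        (\<forall>i\<in>I. \<forall>j\<in>I. g p (E i p) (E j p) = (if i = j then 1 else 0)))"

text \<open>The components of \<open>v\<close> along \<open>D p\<close> and along its orthogonal complement.\<close>

definition tan_part ::
  "('a::topological_space, 'e::euclidean_space) atlas \<Rightarrow> 'a metric \<Rightarrow> ('a \<Rightarrow> 'a tvec set) \<Rightarrow>
   'a \<Rightarrow> 'a tvec \<Rightarrow> 'a tvec" where
  "tan_part A g D p v = (THE w. w \<in> D p \<and> v - w \<in> perp A g D p)"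

definition perp_part ::
  "('a::topological_space, 'e::euclidean_space) atlas \<Rightarrow> 'a metric \<Rightarrow> ('a \<Rightarrow> 'a tvec set) \<Rightarrow>
   'a \<Rightarrow> 'a tvec \<Rightarrow> 'a tvec" where
  "perp_part A g D p v = v - tan_part A g D p v"

text \<open>
  With \<open>D\<close> the distribution \<open>range F\<^sub>*\<close>: \<open>shape\<close> is \<open>\<S>\<^sub>V Y\<close> for sections \<open>V\<close> of the complement and
  \<open>Y = F\<^sub>*X\<close> of \<open>D\<close>, and \<open>perp_conn\<close> is \<open>\<nabla>\<^sup>F\<^sup>\<bottom>\<^sub>Z V\<close>, so that
  \<open>nab Y V = - shape V Y + perp_conn Y V\<close>.
\<close>

definition shape ::
  "('a::topological_space, 'e::euclidean_space) atlas \<Rightarrow> 'a metric \<Rightarrow> ('a vfield \<Rightarrow> 'a vfield \<Rightarrow> 'a vfield) \<Rightarrow>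
   ('a \<Rightarrow> 'a tvec set) \<Rightarrow> 'a vfield \<Rightarrow> 'a vfield \<Rightarrow> 'a vfield" where
  "shape A g nab D V Y = (\<lambda>p. - tan_part A g D p (nab Y V p))"

definition perp_conn ::
  "('a::topological_space, 'e::euclidean_space) atlas \<Rightarrow> 'a metric \<Rightarrow> ('a vfield \<Rightarrow> 'a vfield \<Rightarrow> 'a vfield) \<Rightarrow>
   ('a \<Rightarrow> 'a tvec set) \<Rightarrow> 'a vfield \<Rightarrow> 'a vfield \<Rightarrow> 'a vfield" where
  "perp_conn A g nab D Z V = (\<lambda>p. perp_part A g D p (nab Z V p))"

definition perp_totally_geodesic ::
  "('a::topological_space, 'e::euclidean_space) atlas \<Rightarrow> 'a metric \<Rightarrow> ('a vfield \<Rightarrow> 'a vfield \<Rightarrow> 'a vfield) \<Rightarrow>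
   ('a \<Rightarrow> 'a tvec set) \<Rightarrow> bool" where
  "perp_totally_geodesic A g nab D \<longleftrightarrow>
     (\<forall>O' U V. open O' \<and> section_of A O' (perp A g D) U \<and> section_of A O' (perp A g D) V \<longrightarrow>
        (\<forall>p\<in>O'. nab U V p = perp_conn A g nab D U V p))"

text \<open>For an orthonormal frame \<open>(E i)\<close>, \<open>i \<in> I\<close>, of a distribution: the Ricci and scalar curvature of
  the distribution. Both use the curvature of the ambient connection, with traces taken over
  the distribution only.\<close>

definition frame_ricci ::
  "('a::topological_space, 'e::euclidean_space) atlas \<Rightarrow> 'a metric \<Rightarrow> ('a vfield \<Rightarrow> 'a vfield \<Rightarrow> 'a vfield) \<Rightarrow>
   nat set \<Rightarrow> (nat \<Rightarrow> 'a vfield) \<Rightarrow> 'a \<Rightarrow> 'a tvec \<Rightarrow> 'a tvec \<Rightarrow> real" where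
  "frame_ricci A g nab I E p u v = (\<Sum>i\<in>I. g p (curvature_at A nab p (E i p) u v) (E i p))"

definition frame_scalar ::
  "('a::topological_space, 'e::euclidean_space) atlas \<Rightarrow> 'a metric \<Rightarrow> ('a vfield \<Rightarrow> 'a vfield \<Rightarrow> 'a vfield) \<Rightarrow>
   nat set \<Rightarrow> (nat \<Rightarrow> 'a vfield) \<Rightarrow> 'a \<Rightarrow> real" where
  "frame_scalar A g nab I E p = (\<Sum>i\<in>I. frame_ricci A g nab I E p (E i p) (E i p))"

section \<open>Riemannian maps\<close>

definition horizontal ::
  "('a::topological_space, 'e::euclidean_space) atlas \<Rightarrow> 'a metric \<Rightarrow>
   ('b::topological_space, 'f::euclidean_space) atlas \<Rightarrow> ('a \<Rightarrow> 'b) \<Rightarrow> 'a \<Rightarrow> 'a tvec set" where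
  "horizontal A gA B F p = orth_compl A gA p (ker_diff A B F p)"

definition riemannian_map ::
  "('a::topological_space, 'e::euclidean_space) atlas \<Rightarrow> 'a metric \<Rightarrow>
   ('b::topological_space, 'f::euclidean_space) atlas \<Rightarrow> 'b metric \<Rightarrow> ('a \<Rightarrow> 'b) \<Rightarrow> bool" where
  "riemannian_map A gA B gB F \<longleftrightarrow> smooth_map A B F \<and>
     (\<exists>k. 0 < k \<and> k \<le> min DIM('e) DIM('f) \<and> (\<forall>p. dim (range_diff A B F p) = k)) \<and>
     (\<forall>p. differential B F p ` horizontal A gA B F p = range_diff A B F p \<and>
        (\<forall>u\<in>horizontal A gA B F p. \<forall>v\<in>horizontal A gA B F p.
           gB (F p) (differential B F p u) (differential B F p v) = gA p u v))"

end

theory Submission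
  imports Defs
begin

text \<open>
  Write \<open>E\<^sub>j = F\<^sub>*X\<^sub>j\<close>. Evaluating \<open>s\<^sup>N\<close> in the orthonormal frame \<open>E\<^sub>j, e\<^sub>k\<close> gives the two partial scalar
  curvatures plus twice the sum of the mixed terms \<open>g(R(E\<^sub>j, e\<^sub>k)e\<^sub>k, E\<^sub>j)\<close>. Since \<open>(range F\<^sub>*)\<^sup>\<bottom>\<close> is totally
  geodesic, \<open>\<nabla>\<close> along \<open>e\<^sub>k\<close> preserves both distributions, and expanding \<open>R\<close> with
  \<open>\<nabla>\<^bsub>E\<^sub>j\<^esub>e\<^sub>k = - \<S>\<^bsub>e\<^sub>k\<^esub>E\<^sub>j + \<nabla>\<^sup>\<bottom>\<^bsub>E\<^sub>j\<^esub>e\<^sub>k\<close> and \<open>[E\<^sub>j, e\<^sub>k] = \<nabla>\<^bsub>E\<^sub>j\<^esub>e\<^sub>k - \<nabla>\<^bsub>e\<^sub>k\<^esub>E\<^sub>j\<close> yields the formula once \<open>\<S>\<close> is known to be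
  symmetric at \<open>F p\<close>. Away from the image of \<open>F\<close> the distribution need not be integrable, but at
  \<open>F p\<close> the bracket of the \<open>F\<close>-related fields \<open>E\<^sub>i, E\<^sub>j\<close> is \<open>F\<^sub>*[X\<^sub>i, X\<^sub>j]\<close>, which lies in \<open>range F\<^sub>*\<close>.
\<close>

section \<open>Calculus of smooth functions\<close>

text \<open>Openness of \<open>S\<close> makes the derivative at a point of \<open>S\<close> depend
  only on the values on \<open>S\<close>, so equality passes from the functions to their derivatives
  and the induction goes through.\<close>

lemma ck_on_cong:
  assumes "open S" "\<And>x. x \<in> S \<Longrightarrow> f x = g x" "ck_on k S f"
  shows "ck_on k S g"
  using assms(2,3)
proof (induction k arbitrary: f g)
  case 0
  then show ?case by (auto cong: continuous_on_cong_simp)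
next
  case (Suc k)
  have d: "(g has_derivative frechet_derivative f (at x)) (at x)" if "x \<in> S" for x
  proof (rule has_derivative_transform_within_open[OF _ assms(1) that])
    show "(f has_derivative frechet_derivative f (at x)) (at x)"
      using Suc.prems(2) that by (simp add: frechet_derivative_works)
  qed (use Suc.prems(1) in simp)
  have e: "frechet_derivative f (at x) = frechet_derivative g (at x)" if "x \<in> S" for x
    using frechet_derivative_at[OF d[OF that]] by simp
  have "ck_on k S (\<lambda>x. frechet_derivative g (at x) v)" for v
  proof (rule Suc.IH)
    show "frechet_derivative f (at x) v = frechet_derivative g (at x) v" if "x \<in> S" for x
      using e[OF that] by simp
    show "ck_on k S (\<lambda>x. frechet_derivative f (at x) v)"
      using Suc.prems(2) by simp
  qed
  then show ?case
    using d by (auto simp: differentiable_def)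
qed

lemma ck_on_subset: "ck_on k S f \<Longrightarrow> T \<subseteq> S \<Longrightarrow> ck_on k T f"
  by (induction k arbitrary: f) (auto intro: continuous_on_subset)

lemma ck_on_UN:
  assumes "\<And>i. i \<in> I \<Longrightarrow> open (S i)" "\<And>i. i \<in> I \<Longrightarrow> ck_on k (S i) f"
  shows "ck_on k (\<Union>i\<in>I. S i) f"
  using assms(2)
  by (induction k arbitrary: f) (auto intro!: continuous_on_open_UN assms(1))

lemma ck_on_Suc_imp: "ck_on (Suc k) S f \<Longrightarrow> ck_on k S f"
proof (induction k arbitrary: f)
  case 0
  then show ?case
    by (auto intro!: continuous_at_imp_continuous_on differentiable_imp_continuous_within)
next
  case (Suc k)
  from Suc.prems have "\<forall>v. ck_on (Suc k) S (\<lambda>x. frechet_derivative f (at x) v)"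
    and d: "\<forall>x\<in>S. f differentiable (at x)"
    by simp_all
  then have "\<forall>v. ck_on k S (\<lambda>x. frechet_derivative f (at x) v)"
    using Suc.IH by blast
  with d show ?case by simp
qed

text \<open>Lets an explicitly computed derivative \<open>f'\<close> replace the chosen
  \<open>frechet_derivative\<close>: both agree on \<open>S\<close> by uniqueness, and
  \<open>ck_on_cong\<close> transfers smoothness.\<close>

lemma ck_on_SucI:
  assumes "open S" "\<And>x. x \<in> S \<Longrightarrow> (f has_derivative f' x) (at x)"
    "\<And>v. ck_on k S (\<lambda>x. f' x v)"
  shows "ck_on (Suc k) S f"
proof -
  have "ck_on k S (\<lambda>x. frechet_derivative f (at x) v)" for v
    by (rule ck_on_cong[OF assms(1) _ assms(3)[of v]])
      (use frechet_derivative_at[OF assms(2)] in auto)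
  then show ?thesis
    using assms(2) by (auto simp: differentiable_def)
qed

lemma ck_on_SucD:
  assumes "ck_on (Suc k) S f" "x \<in> S"
  shows "(f has_derivative frechet_derivative f (at x)) (at x)"
  using assms by (auto simp: frechet_derivative_works)

lemma ck_on_const: "open S \<Longrightarrow> ck_on k S (\<lambda>x. c)"
  by (induction k arbitrary: c)
    (auto intro!: ck_on_SucI[where f' = "\<lambda>x v. 0"] simp del: ck_on.simps(2))

lemma ck_on_add:
  assumes "open S" "ck_on k S f" "ck_on k S g"
  shows "ck_on k S (\<lambda>x. f x + g x)"
  using assms(2,3)
proof (induction k arbitrary: f g)
  case 0
  then show ?case by (auto intro: continuous_intros)
next
  case (Suc k)
  show ?case
  proof (rule ck_on_SucI[OF assms(1)])
    fix x assume "x \<in> S"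
    with Suc.prems show "((\<lambda>x. f x + g x) has_derivative
        (\<lambda>v. frechet_derivative f (at x) v + frechet_derivative g (at x) v)) (at x)"
      by (intro has_derivative_add ck_on_SucD)
  next
    fix v show "ck_on k S (\<lambda>x. frechet_derivative f (at x) v + frechet_derivative g (at x) v)"
      using Suc by simp
  qed
qed

lemma ck_on_sum:
  assumes "open S" "\<And>i. i \<in> I \<Longrightarrow> ck_on k S (f i)"
  shows "ck_on k S (\<lambda>x. \<Sum>i\<in>I. f i x)"
  using assms(2)
  by (induction I rule: infinite_finite_induct) (auto intro: ck_on_const ck_on_add assms(1))

lemma ck_on_scaleR:
  fixes f :: "'e::real_normed_vector \<Rightarrow> real" and g :: "'e \<Rightarrow> 'f::real_normed_vector"
  assumes "open S" "ck_on k S f" "ck_on k S g"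
  shows "ck_on k S (\<lambda>x. f x *\<^sub>R g x)"
  using assms(2,3)
proof (induction k arbitrary: f g)
  case 0
  then show ?case by (auto intro: continuous_intros)
next
  case (Suc k)
  show ?case
  proof (rule ck_on_SucI[OF assms(1)])
    fix x assume "x \<in> S"
    with Suc.prems show "((\<lambda>x. f x *\<^sub>R g x) has_derivative
        (\<lambda>v. f x *\<^sub>R frechet_derivative g (at x) v + frechet_derivative f (at x) v *\<^sub>R g x)) (at x)"
      by (intro has_derivative_scaleR ck_on_SucD)
  next
    fix v
    have "ck_on k S f" "ck_on k S g"
      using Suc.prems ck_on_Suc_imp by blast+
    then show "ck_on k S (\<lambda>x. f x *\<^sub>R frechet_derivative g (at x) v + frechet_derivative f (at x) v *\<^sub>R g x)"
      using Suc by (intro ck_on_add assms(1)) simp_all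
  qed
qed

lemma ck_on_bounded_linear:
  assumes "bounded_linear h" "open S" "ck_on k S f"
  shows "ck_on k S (\<lambda>x. h (f x))"
  using assms(3)
proof (induction k arbitrary: f)
  case 0
  then show ?case
    using assms(1) by (auto intro: bounded_linear.continuous_on)
next
  case (Suc k)
  show ?case
  proof (rule ck_on_SucI[OF assms(2)])
    fix x assume "x \<in> S"
    with Suc.prems show "((\<lambda>x. h (f x)) has_derivative
        (\<lambda>v. h (frechet_derivative f (at x) v))) (at x)"
      by (intro bounded_linear.has_derivative[OF assms(1)] ck_on_SucD)
  next
    fix v show "ck_on k S (\<lambda>x. h (frechet_derivative f (at x) v))"
      using Suc by simp
  qed
qed

text \<open>The chain rule differentiates \<open>g\<close> in a direction that varies with
  \<open>x\<close>, whereas \<open>ck_on\<close> speaks about fixed directions. Expanding the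
  direction in \<open>Basis\<close> leaves finitely many products of coordinates of the derivative
  of \<open>f\<close> with derivatives of \<open>g\<close> in fixed directions.\<close>

lemma ck_on_compose:
  fixes f :: "'e::real_normed_vector \<Rightarrow> 'f::euclidean_space"
  assumes "open S" "f ` S \<subseteq> T" "ck_on k S f" "ck_on k T g"
  shows "ck_on k S (\<lambda>x. g (f x))"
  using assms(3,4)
proof (induction k arbitrary: g)
  case 0
  then show ?case
    using assms(2) by (auto intro: continuous_on_compose2)
next
  case (Suc k)
  let ?Dg = "\<lambda>b y. frechet_derivative g (at y) b"
  have f: "ck_on k S f"
    using Suc.prems(1) ck_on_Suc_imp by blast
  show ?case
  proof (rule ck_on_SucI[OF assms(1)])
    fix x assume x: "x \<in> S"
    have lin: "linear (frechet_derivative g (at (f x)))"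
      using ck_on_SucD[OF Suc.prems(2)] x assms(2) has_derivative_linear by blast
    have "(\<Sum>b\<in>Basis. (frechet_derivative f (at x) v \<bullet> b) *\<^sub>R ?Dg b (f x)) =
        frechet_derivative g (at (f x)) (frechet_derivative f (at x) v)" for v
    proof -
      have "frechet_derivative g (at (f x)) (frechet_derivative f (at x) v) =
          frechet_derivative g (at (f x)) (\<Sum>b\<in>Basis. (frechet_derivative f (at x) v \<bullet> b) *\<^sub>R b)"
        by (simp only: euclidean_representation)
      then show ?thesis
        by (simp add: linear_sum[OF lin] linear_scale[OF lin])
    qed
    moreover have "((\<lambda>x. g (f x)) has_derivative
        (\<lambda>v. frechet_derivative g (at (f x)) (frechet_derivative f (at x) v))) (at x)"
      using x assms(2)
      by (intro has_derivative_compose[OF ck_on_SucD[OF Suc.prems(1) x]] ck_on_SucD[OF Suc.prems(2)]) auto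
    ultimately show "((\<lambda>x. g (f x)) has_derivative
        (\<lambda>v. \<Sum>b\<in>Basis. (frechet_derivative f (at x) v \<bullet> b) *\<^sub>R ?Dg b (f x))) (at x)"
      by simp
  next
    fix v
    show "ck_on k S (\<lambda>x. \<Sum>b\<in>Basis. (frechet_derivative f (at x) v \<bullet> b) *\<^sub>R ?Dg b (f x))"
      using Suc.prems f
      by (intro ck_on_sum ck_on_scaleR assms(1) Suc.IH
          ck_on_bounded_linear[OF bounded_linear_inner_left]) auto
  qed
qed

lemma cinf_on_cong:
  "open S \<Longrightarrow> (\<And>x. x \<in> S \<Longrightarrow> f x = g x) \<Longrightarrow> cinf_on S f \<Longrightarrow> cinf_on S g"
  unfolding cinf_on_def using ck_on_cong by blast

lemma chart_image_open:
  assumes "smooth_atlas A" "(V, \<phi>) \<in> A" "open U"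
  shows "open (\<phi> ` (V \<inter> U))"
proof -
  have h: "homeomorphism V (\<phi> ` V) \<phi> (inv_into V \<phi>)" "open (\<phi> ` V)"
    using assms(1,2) by (auto simp: smooth_atlas_def)
  have "openin (top_of_set (\<phi> ` V)) (\<phi> ` (V \<inter> U))"
    using homeomorphism_imp_open_map[OF h(1)] assms(3) by (metis openin_open)
  with h(2) show ?thesis
    using openin_open_trans by blast
qed

lemma chart_inv:
  assumes "smooth_atlas A" "(V, \<phi>) \<in> A" "x \<in> V"
  shows "inv_into V \<phi> (\<phi> x) = x"
  using assms homeomorphism_apply1[of V "\<phi> ` V" \<phi> "inv_into V \<phi>" x]
  by (auto simp: smooth_atlas_def)

lemma atlas_cover:
  assumes "smooth_atlas A"
  obtains V \<phi> where "(V, \<phi>) \<in> A" "x \<in> V" "open V"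
  using assms UNIV_I[of x] unfolding smooth_atlas_def by blast

section \<open>Smooth functions on a manifold\<close>

lemma smooth_fun_subset: "smooth_fun A U f \<Longrightarrow> V \<subseteq> U \<Longrightarrow> smooth_fun A V f"
  unfolding smooth_fun_def cinf_on_def
  by (fast intro: ck_on_subset)

lemma smooth_fun_cong:
  assumes "smooth_atlas A" "open U" "\<And>x. x \<in> U \<Longrightarrow> f x = h x" "smooth_fun A U f"
  shows "smooth_fun A U h"
  unfolding smooth_fun_def
proof (safe)
  fix V \<phi> assume V: "(V, \<phi>) \<in> A"
  show "cinf_on (\<phi> ` (V \<inter> U)) (h \<circ> inv_into V \<phi>)"
    by (rule cinf_on_cong[OF chart_image_open[OF assms(1) V assms(2)], of "f \<circ> inv_into V \<phi>"])
      (use assms(3,4) V chart_inv[OF assms(1) V] in \<open>auto simp: smooth_fun_def\<close>)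
qed

lemma smooth_fun_const:
  assumes "smooth_atlas A" "open U"
  shows "smooth_fun A U (\<lambda>x. c)"
  using chart_image_open[OF assms(1) _ assms(2)]
  by (auto simp: smooth_fun_def cinf_on_def o_def intro!: ck_on_const)

lemma smooth_fun_add:
  assumes "smooth_atlas A" "open U" "smooth_fun A U f" "smooth_fun A U h"
  shows "smooth_fun A U (\<lambda>x. f x + h x)"
  using assms(3,4) chart_image_open[OF assms(1) _ assms(2)]
  by (auto simp: smooth_fun_def cinf_on_def o_def intro!: ck_on_add)

lemma smooth_fun_mult:
  assumes "smooth_atlas A" "open U" "smooth_fun A U f" "smooth_fun A U h"
  shows "smooth_fun A U (\<lambda>x. f x * h x)"
  using assms(3,4) chart_image_open[OF assms(1) _ assms(2)]
  by (auto simp: smooth_fun_def cinf_on_def o_def simp flip: real_scaleR_def intro!: ck_on_scaleR)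

text \<open>The preimage of \<open>U\<close> is cut into open pieces \<open>?S C\<close>, one for
  each chart \<open>C\<close> of the target. On such a piece the function is \<open>?f\<close> after
  \<open>?F\<close>, to which the chain rule applies; \<open>ck_on_UN\<close> glues the
  pieces.\<close>

lemma smooth_fun_compose:
  assumes A: "smooth_atlas A" and B: "smooth_atlas B" and F: "smooth_map A B F"
    and U: "open U" "smooth_fun B U f"
  shows "smooth_fun A (F -` U) (f \<circ> F)"
  unfolding smooth_fun_def
proof (safe)
  fix V \<phi> assume V: "(V, \<phi>) \<in> A"
  have cF: "continuous_on UNIV F"
    using F by (simp add: smooth_map_def)
  let ?S = "\<lambda>C. \<phi> ` (V \<inter> F -` (fst C \<inter> U))"
  have "cinf_on (\<Union>C\<in>B. ?S C) (f \<circ> F \<circ> inv_into V \<phi>)"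
    unfolding cinf_on_def
  proof (intro allI ck_on_UN)
    fix C assume C: "C \<in> B"
    obtain W \<psi> where C': "C = (W, \<psi>)" by (cases C)
    have W: "(W, \<psi>) \<in> B" "open W"
      using C C' B by (auto simp: smooth_atlas_def)
    show o: "open (?S C)"
      using W U cF by (auto intro!: chart_image_open[OF A V] open_vimage simp: C')
    fix k
    let ?f = "f \<circ> inv_into W \<psi>" and ?F = "\<psi> \<circ> F \<circ> inv_into V \<phi>"
    have "ck_on k (?S C) (\<lambda>x. ?f (?F x))"
    proof (rule ck_on_compose[OF o, where T = "\<psi> ` (W \<inter> U)"])
      show "?F ` ?S C \<subseteq> \<psi> ` (W \<inter> U)"
        by (auto simp: C' chart_inv[OF A V])
      have "ck_on k (\<phi> ` (V \<inter> F -` W)) ?F"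
        using F V W(1) unfolding smooth_map_def cinf_on_def by blast
      then show "ck_on k (?S C) ?F"
        by (rule ck_on_subset) (auto simp: C')
      show "ck_on k (\<psi> ` (W \<inter> U)) ?f"
        using U W by (auto simp: smooth_fun_def cinf_on_def)
    qed
    then show "ck_on k (?S C) (f \<circ> F \<circ> inv_into V \<phi>)"
      by (rule ck_on_cong[OF o, rotated])
        (auto simp: C' chart_inv[OF A V] chart_inv[OF B W(1)])
  qed
  moreover have "(\<Union>C\<in>B. ?S C) = \<phi> ` (V \<inter> F -` U)"
  proof -
    have "\<exists>C\<in>B. F x \<in> fst C" for x
      by (metis atlas_cover[OF B] fst_conv)
    then show ?thesis by blast
  qed
  ultimately show "cinf_on (\<phi> ` (V \<inter> F -` U)) (f \<circ> F \<circ> inv_into V \<phi>)" by simp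
qed

lemma smooth_nearI: "open U \<Longrightarrow> p \<in> U \<Longrightarrow> smooth_fun A U f \<Longrightarrow> smooth_near A p f"
  by (auto simp: smooth_near_def)

lemma smooth_near_cong:
  assumes "smooth_atlas A" "open U" "p \<in> U" "\<And>x. x \<in> U \<Longrightarrow> f x = h x"
  shows "smooth_near A p f \<longleftrightarrow> smooth_near A p h"
proof -
  have "smooth_near A p h" if f: "smooth_near A p f" "\<And>x. x \<in> U \<Longrightarrow> f x = h x" for f h
  proof -
    obtain V where V: "open V" "p \<in> V" "smooth_fun A V f"
      using f(1) by (auto simp: smooth_near_def)
    have "smooth_fun A (V \<inter> U) h"
      using f(2) V assms(2)
      by (intro smooth_fun_cong[OF assms(1) _ _ smooth_fun_subset[OF V(3)]]) auto
    then show ?thesis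
      using V assms(2,3) by (intro smooth_nearI[of "V \<inter> U"]) auto
  qed
  from this[of f h] this[of h f] show ?thesis
    using assms(4) by auto
qed

lemma smooth_near_common:
  assumes "smooth_near A p f" "smooth_near A p h"
  obtains U where "open U" "p \<in> U" "smooth_fun A U f" "smooth_fun A U h"
proof -
  obtain U V where "open U" "p \<in> U" "smooth_fun A U f" "open V" "p \<in> V" "smooth_fun A V h"
    using assms by (auto simp: smooth_near_def)
  then show ?thesis
    by (intro that[of "U \<inter> V"]) (auto intro: smooth_fun_subset)
qed

lemma smooth_near_compose:
  assumes "smooth_atlas A" "smooth_atlas B" "smooth_map A B F" "smooth_near B (F p) f"
  shows "smooth_near A p (f \<circ> F)"
proof -
  obtain U where U: "open U" "F p \<in> U" "smooth_fun B U f"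
    using assms(4) by (auto simp: smooth_near_def)
  have "open (F -` U)"
    using assms(3) U(1) by (auto simp: smooth_map_def intro: open_vimage)
  then show ?thesis
    using smooth_fun_compose[OF assms(1-3) U(1,3)] U(2) by (intro smooth_nearI) auto
qed

section \<open>Tangent vectors and vector fields\<close>

lemma zero_in_tangent_space: "0 \<in> tangent_space A p"
  by (auto simp: tangent_space_def)

lemma subspace_tangent_space:
  assumes "smooth_atlas A"
  shows "subspace (tangent_space A p)"
proof (rule subspaceI[OF zero_in_tangent_space])
  fix u v :: "'a tvec" assume "u \<in> tangent_space A p" "v \<in> tangent_space A p"
  then show "u + v \<in> tangent_space A p"
    unfolding tangent_space_def by (simp add: algebra_simps) metis
next
  fix u :: "'a tvec" and c :: real assume "u \<in> tangent_space A p"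
  then show "c *\<^sub>R u \<in> tangent_space A p"
    unfolding tangent_space_def scaleR_fun_def by (simp add: algebra_simps)
qed

text \<open>Covers functions that are not smooth near \<open>p\<close> as well: if \<open>f\<close>
  is not, neither is \<open>h\<close>, and the normalisation of tangent vectors makes both values
  0.\<close>

lemma tangent_cong:
  assumes "v \<in> tangent_space A p" "smooth_atlas A" "open U" "p \<in> U" "\<And>x. x \<in> U \<Longrightarrow> f x = h x"
  shows "v f = v h"
proof (cases "smooth_near A p f")
  case True
  then show ?thesis
    using assms unfolding tangent_space_def by blast
next
  case False
  then show ?thesis
    using assms smooth_near_cong[OF assms(2-5)] unfolding tangent_space_def by auto
qed

lemma tangent_add:
  "v \<in> tangent_space A p \<Longrightarrow> smooth_near A p f \<Longrightarrow> smooth_near A p h \<Longrightarrow>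
    v (\<lambda>x. f x + h x) = v f + v h"
  unfolding tangent_space_def by blast

lemma tangent_mult:
  "v \<in> tangent_space A p \<Longrightarrow> smooth_near A p f \<Longrightarrow> smooth_near A p h \<Longrightarrow>
    v (\<lambda>x. f x * h x) = f p * v h + h p * v f"
  unfolding tangent_space_def by blast

lemma tangent_cmult:
  "v \<in> tangent_space A p \<Longrightarrow> smooth_near A p f \<Longrightarrow> v (\<lambda>x. c * f x) = c * v f"
  unfolding tangent_space_def by blast

text \<open>The product rule for \<open>1 * 1\<close> shows that the derivative of the constant 1 is
  twice itself; homogeneity does the rest.\<close>

lemma tangent_const:
  assumes "v \<in> tangent_space A p" "smooth_atlas A"
  shows "v (\<lambda>x. c) = 0"
proof -
  have s: "smooth_near A p (\<lambda>x. c)" for c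
    by (rule smooth_nearI[of UNIV]) (auto intro: smooth_fun_const assms)
  have "v (\<lambda>x. 1 * 1) = 0"
    using tangent_mult[OF assms(1) s[of 1] s[of 1]] by simp
  then show ?thesis
    using tangent_cmult[OF assms(1) s[of 1], of c] by simp
qed

lemma vector_field_tangent: "vector_field A U X \<Longrightarrow> p \<in> U \<Longrightarrow> X p \<in> tangent_space A p"
  by (simp add: vector_field_def)

lemma vector_field_smooth:
  "vector_field A U X \<Longrightarrow> open V \<Longrightarrow> V \<subseteq> U \<Longrightarrow> smooth_fun A V f \<Longrightarrow> smooth_fun A V (\<lambda>p. X p f)"
  by (simp add: vector_field_def)

lemma vector_field_smooth_near:
  assumes "vector_field A U X" "open U" "p \<in> U" "smooth_near A p f"
  shows "smooth_near A p (\<lambda>q. X q f)"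
proof -
  obtain V where V: "open V" "p \<in> V" "smooth_fun A V f"
    using assms(4) by (auto simp: smooth_near_def)
  have "smooth_fun A (U \<inter> V) (\<lambda>q. X q f)"
    using V assms by (intro vector_field_smooth[OF assms(1)] smooth_fun_subset[OF V(3)]) auto
  then show ?thesis
    using V assms by (intro smooth_nearI[of "U \<inter> V"]) auto
qed

lemma vector_field_subset: "vector_field A U X \<Longrightarrow> V \<subseteq> U \<Longrightarrow> vector_field A V X"
  unfolding vector_field_def by (meson subset_iff subset_trans)

lemma vector_field_cong:
  assumes "smooth_atlas A" "\<And>p. p \<in> U \<Longrightarrow> X p = Y p" "vector_field A U X"
  shows "vector_field A U Y"
  unfolding vector_field_def
proof (safe)
  show "Y p \<in> tangent_space A p" if "p \<in> U" for p
    using assms(2)[OF that] vector_field_tangent[OF assms(3) that] by simp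
  show "smooth_fun A V (\<lambda>p. Y p f)" if "open V" "V \<subseteq> U" "smooth_fun A V f" for V f
    by (rule smooth_fun_cong[OF assms(1) that(1) _ vector_field_smooth[OF assms(3) that]])
      (use assms(2) that in auto)
qed

lemma vector_field_add:
  assumes "smooth_atlas A" "vector_field A U X" "vector_field A U Y"
  shows "vector_field A U (X + Y)"
  unfolding vector_field_def
  using assms
  by (auto intro!: subspace_add[OF subspace_tangent_space] smooth_fun_add
      intro: vector_field_tangent vector_field_smooth)

lemma vector_field_scale:
  assumes "smooth_atlas A" "smooth_fun A U f" "vector_field A U X"
  shows "vector_field A U (\<lambda>q. f q *\<^sub>R X q)"
  unfolding vector_field_def
proof (safe)
  show "f p *\<^sub>R X p \<in> tangent_space A p" if "p \<in> U" for p
    using subspace_scale[OF subspace_tangent_space[OF assms(1)] vector_field_tangent[OF assms(3) that]] .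
  show "smooth_fun A V (\<lambda>p. (f p *\<^sub>R X p) h)" if "open V" "V \<subseteq> U" "smooth_fun A V h" for V h
    using smooth_fun_mult[OF assms(1) that(1) smooth_fun_subset[OF assms(2) that(2)]
        vector_field_smooth[OF assms(3) that]]
    by (simp add: scaleR_fun_def)
qed

lemma vector_field_0: "smooth_atlas A \<Longrightarrow> vector_field A U 0"
  by (auto simp: vector_field_def zero_in_tangent_space intro: smooth_fun_const)

lemma vector_field_sum:
  assumes "smooth_atlas A" "\<And>i. i \<in> I \<Longrightarrow> vector_field A U (X i)"
  shows "vector_field A U (\<Sum>i\<in>I. X i)"
  using assms(2)
  by (induction I rule: infinite_finite_induct)
    (auto intro: vector_field_0 vector_field_add assms(1))

text \<open>The second-order operator sending \<open>f\<close> to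
  \<open>X p (\<lambda>q. Y q f)\<close> fails the product rule by
  \<open>X p f * Y p h + X p h * Y p f\<close>. This error is symmetric in \<open>X\<close> and
  \<open>Y\<close>, so it cancels in the bracket.\<close>

lemma lie_bracket_tangent:
  assumes A: "smooth_atlas A" and U: "open U" "p \<in> U"
    and X: "vector_field A U X" and Y: "vector_field A U Y"
  shows "lie_bracket A X Y p \<in> tangent_space A p"
proof -
  note t = vector_field_tangent[OF X U(2)] vector_field_tangent[OF Y U(2)]
  have cong: "lie_bracket A X Y p f = lie_bracket A X Y p h"
    if "open V" "p \<in> V" "\<And>x. x \<in> V \<Longrightarrow> f x = h x" for f h V
  proof -
    have "Z q f = Z q h" if Z: "vector_field A U Z" and q: "q \<in> U \<inter> V" for q Z
      using q by (intro tangent_cong[OF vector_field_tangent[OF Z] A \<open>open V\<close>])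
        (auto simp: \<open>\<And>x. x \<in> V \<Longrightarrow> f x = h x\<close>)
    then have *: "v (\<lambda>q. Z q f) = v (\<lambda>q. Z q h)"
      if "vector_field A U Z" "v \<in> tangent_space A p" for Z v
      using that \<open>open V\<close> \<open>p \<in> V\<close> U by (intro tangent_cong[OF that(2) A, of "U \<inter> V"]) auto
    show ?thesis
      using *[OF X t(2)] *[OF Y t(1)] smooth_near_cong[OF A that] by (simp add: lie_bracket_def)
  qed
  have add: "lie_bracket A X Y p (\<lambda>x. f x + h x) = lie_bracket A X Y p f + lie_bracket A X Y p h"
    and mult: "lie_bracket A X Y p (\<lambda>x. f x * h x) = f p * lie_bracket A X Y p h + h p * lie_bracket A X Y p f"
    if f: "smooth_near A p f" and h: "smooth_near A p h" for f h
  proof -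
    obtain V where V: "open V" "p \<in> V" "smooth_fun A V f" "smooth_fun A V h"
      using smooth_near_common[OF f h] .
    have UV: "open (U \<inter> V)" "p \<in> U \<inter> V"
      using U V by auto
    have fh: "smooth_near A p (\<lambda>x. f x + h x)" "smooth_near A p (\<lambda>x. f x * h x)"
      using V by (auto intro!: smooth_nearI[of V] smooth_fun_add smooth_fun_mult A)
    have m: "smooth_near A p (\<lambda>x. a x * b x)" if "smooth_near A p a" "smooth_near A p b" for a b
      using smooth_near_common[OF that] by (metis A smooth_fun_mult smooth_nearI)
    \<comment> \<open>Stated for arbitrary \<open>Z\<close> and \<open>v\<close> so that one
      computation serves both terms of the bracket.\<close>
    have a: "v (\<lambda>q. Z q (\<lambda>x. f x + h x)) = v (\<lambda>q. Z q f) + v (\<lambda>q. Z q h)"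
      and b: "v (\<lambda>q. Z q (\<lambda>x. f x * h x)) =
        f p * v (\<lambda>q. Z q h) + Z p h * v f + h p * v (\<lambda>q. Z q f) + Z p f * v h"
      if Z: "vector_field A U Z" and v: "v \<in> tangent_space A p" for Z v
    proof -
      note z = vector_field_smooth_near[OF Z U f] vector_field_smooth_near[OF Z U h]
      have n: "Z q \<in> tangent_space A q" "smooth_near A q f" "smooth_near A q h" if "q \<in> U \<inter> V" for q
        using that V Z by (auto intro: smooth_nearI vector_field_tangent)
      have "v (\<lambda>q. Z q (\<lambda>x. f x + h x)) = v (\<lambda>q. Z q f + Z q h)"
        by (rule tangent_cong[OF v A UV]) (rule tangent_add[OF n])
      then show "v (\<lambda>q. Z q (\<lambda>x. f x + h x)) = v (\<lambda>q. Z q f) + v (\<lambda>q. Z q h)"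
        using z by (simp add: tangent_add[OF v])
      have "v (\<lambda>q. Z q (\<lambda>x. f x * h x)) = v (\<lambda>q. f q * Z q h + h q * Z q f)"
        by (rule tangent_cong[OF v A UV]) (rule tangent_mult[OF n])
      also have "\<dots> = v (\<lambda>q. f q * Z q h) + v (\<lambda>q. h q * Z q f)"
        by (intro tangent_add[OF v] m f h z)
      finally show "v (\<lambda>q. Z q (\<lambda>x. f x * h x)) =
        f p * v (\<lambda>q. Z q h) + Z p h * v f + h p * v (\<lambda>q. Z q f) + Z p f * v h"
        using z f h by (simp add: tangent_mult[OF v])
    qed
    show "lie_bracket A X Y p (\<lambda>x. f x + h x) = lie_bracket A X Y p f + lie_bracket A X Y p h"
      using f h fh a[OF X t(2)] a[OF Y t(1)] by (simp add: lie_bracket_def)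
    show "lie_bracket A X Y p (\<lambda>x. f x * h x) = f p * lie_bracket A X Y p h + h p * lie_bracket A X Y p f"
      using f h fh b[OF X t(2)] b[OF Y t(1)] by (simp add: lie_bracket_def algebra_simps)
  qed
  have const: "smooth_near A p (\<lambda>x. c)" for c
    by (rule smooth_nearI[of UNIV]) (auto intro: smooth_fun_const A)
  have "lie_bracket A X Y p (\<lambda>x. c) = 0" for c
  proof -
    have "Z q (\<lambda>x. c) = 0" if "vector_field A U Z" "q \<in> U" for Z q
      using tangent_const[OF vector_field_tangent[OF that] A] .
    then have *: "v (\<lambda>q. Z q (\<lambda>x. c)) = 0" if "vector_field A U Z" "v \<in> tangent_space A p" for v Z
      using tangent_cong[OF that(2) A U, of "\<lambda>q. Z q (\<lambda>x. c)" "\<lambda>q. 0"] that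
        tangent_const[OF that(2) A] by auto
    show ?thesis
      using *[OF X t(2)] *[OF Y t(1)] by (simp add: lie_bracket_def)
  qed
  \<comment> \<open>Homogeneity is the product rule with a constant first factor, since the bracket
    annihilates constants.\<close>
  then have cmult: "lie_bracket A X Y p (\<lambda>x. c * f x) = c * lie_bracket A X Y p f"
    if "smooth_near A p f" for c f
    using mult[OF const that, of c] by simp
  show ?thesis
    unfolding tangent_space_def mem_Collect_eq
  proof (intro conjI allI impI)
    show "lie_bracket A X Y p f = 0" if "\<not> smooth_near A p f" for f
      using that by (simp add: lie_bracket_def)
    show "lie_bracket A X Y p f = lie_bracket A X Y p h"
      if "smooth_near A p f \<and> open U \<and> p \<in> U \<and> (\<forall>x\<in>U. f x = h x)" for f h U
      using that by (intro cong[of U]) auto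
  qed (auto intro: add mult cmult)
qed

text \<open>Relatedness says that \<open>Z2\<close> applied to \<open>f\<close>, composed with
  \<open>F\<close>, is \<open>T2\<close> applied to \<open>f \<circ> F\<close>. Using this for both
  fields turns each second-order term of the bracket at \<open>F p\<close> into the corresponding
  term at \<open>p\<close>.\<close>

lemma lie_bracket_related:
  assumes A: "smooth_atlas A" and B: "smooth_atlas B" and F: "smooth_map A B F"
    and W: "open W" "p \<in> W" and U: "open U" "F ` W \<subseteq> U"
    and X: "vector_field A W X1" "vector_field A W X2"
    and Y: "vector_field B U Y1" "vector_field B U Y2"
    and rel: "\<And>x. x \<in> W \<Longrightarrow> Y1 (F x) = differential B F x (X1 x)"
      "\<And>x. x \<in> W \<Longrightarrow> Y2 (F x) = differential B F x (X2 x)"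
  shows "lie_bracket B Y1 Y2 (F p) = differential B F p (lie_bracket A X1 X2 p)"
proof (rule ext)
  fix f
  show "lie_bracket B Y1 Y2 (F p) f = differential B F p (lie_bracket A X1 X2 p) f"
  proof (cases "smooth_near B (F p) f")
    case False
    then show ?thesis by (simp add: lie_bracket_def differential_def)
  next
    case True
    then obtain V where V: "open V" "F p \<in> V" "smooth_fun B V f"
      by (auto simp: smooth_near_def)
    have oF: "open (F -` V)"
      using F V(1) by (auto simp: smooth_map_def intro: open_vimage)
    have Fp: "F p \<in> U"
      using W U by auto
    have *: "Z1 (F p) (\<lambda>y. Z2 y f) = T1 p (\<lambda>x. T2 x (f \<circ> F))"
      if Z: "vector_field B U Z2" and T: "vector_field A W T1"
        and r: "\<And>x. x \<in> W \<Longrightarrow> Z1 (F x) = differential B F x (T1 x)"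
          "\<And>x. x \<in> W \<Longrightarrow> Z2 (F x) = differential B F x (T2 x)" for Z1 Z2 T1 T2
    proof -
      have "Z1 (F p) (\<lambda>y. Z2 y f) = T1 p ((\<lambda>y. Z2 y f) \<circ> F)"
        using vector_field_smooth_near[OF Z U(1) Fp True] W
        by (simp add: r differential_def)
      also have "\<dots> = T1 p (\<lambda>x. T2 x (f \<circ> F))"
      proof (rule tangent_cong[OF vector_field_tangent[OF T W(2)] A])
        show "open (W \<inter> F -` V)" "p \<in> W \<inter> F -` V"
          using W V oF by auto
        show "((\<lambda>y. Z2 y f) \<circ> F) x = T2 x (f \<circ> F)" if "x \<in> W \<inter> F -` V" for x
          using that V smooth_nearI[OF V(1) _ V(3), of "F x"] by (simp add: r differential_def)
      qed
      finally show ?thesis .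
    qed
    show ?thesis
      using True smooth_near_compose[OF A B F True]
        *[OF Y(2) X(1) rel] *[OF Y(1) X(2) rel(2,1)]
      by (simp add: lie_bracket_def differential_def del: comp_apply)
  qed
qed

section \<open>The Levi-Civita connection and its curvature\<close>

lemma sum_fun_apply: "sum f K x = (\<Sum>i\<in>K. f i x)"
  by (induction K rule: infinite_finite_induct) auto

locale riemannian_manifold =
  fixes A :: "('a::{t2_space,second_countable_topology}, 'e::euclidean_space) atlas"
    and g :: "'a metric" and nab :: "'a vfield \<Rightarrow> 'a vfield \<Rightarrow> 'a vfield"
  assumes atlas: "smooth_atlas A" and metric: "riemannian_metric A g"
    and levi_civita: "levi_civita A g nab"
begin

abbreviation "T \<equiv> tangent_space A"
abbreviation "vf \<equiv> vector_field A"

lemma T_add: "u \<in> T p \<Longrightarrow> v \<in> T p \<Longrightarrow> u + v \<in> T p"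
  and T_scale: "u \<in> T p \<Longrightarrow> c *\<^sub>R u \<in> T p"
  and T_diff: "u \<in> T p \<Longrightarrow> v \<in> T p \<Longrightarrow> u - v \<in> T p"
  and T_sum: "(\<And>i. i \<in> I \<Longrightarrow> w i \<in> T p) \<Longrightarrow> sum w I \<in> T p"
  using subspace_tangent_space[OF atlas, of p]
  by (auto intro: subspace_add subspace_scale subspace_diff subspace_sum)

lemma g_sym: "u \<in> T p \<Longrightarrow> v \<in> T p \<Longrightarrow> g p u v = g p v u"
  using metric by (auto simp: riemannian_metric_def)

lemma g_lin: "u \<in> T p \<Longrightarrow> v \<in> T p \<Longrightarrow> w \<in> T p \<Longrightarrow>
    g p (a *\<^sub>R u + b *\<^sub>R v) w = a * g p u w + b * g p v w"
  using metric unfolding riemannian_metric_def by simp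

lemma g_smooth: "open U \<Longrightarrow> vf U X \<Longrightarrow> vf U Y \<Longrightarrow> smooth_fun A U (\<lambda>p. g p (X p) (Y p))"
  using metric by (auto simp: riemannian_metric_def)

lemma g_add: "u \<in> T p \<Longrightarrow> v \<in> T p \<Longrightarrow> w \<in> T p \<Longrightarrow> g p (u + v) w = g p u w + g p v w"
  using g_lin[of u p v w 1 1] by simp

lemma g_scale: "u \<in> T p \<Longrightarrow> w \<in> T p \<Longrightarrow> g p (a *\<^sub>R u) w = a * g p u w"
  using g_lin[of u p u w a 0] by simp

lemma g_minus: "u \<in> T p \<Longrightarrow> w \<in> T p \<Longrightarrow> g p (- u) w = - g p u w"
  using g_scale[of u p w "-1"] by simp

lemma g_diff: "u \<in> T p \<Longrightarrow> v \<in> T p \<Longrightarrow> w \<in> T p \<Longrightarrow> g p (u - v) w = g p u w - g p v w"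
  using g_lin[of u p v w 1 "-1"] by simp

lemma g_zero: "w \<in> T p \<Longrightarrow> g p 0 w = 0"
  using g_scale[of w p w 0] by simp

lemma g_sum: "(\<And>i. i \<in> I \<Longrightarrow> u i \<in> T p) \<Longrightarrow> w \<in> T p \<Longrightarrow> g p (\<Sum>i\<in>I. u i) w = (\<Sum>i\<in>I. g p (u i) w)"
  by (induction I rule: infinite_finite_induct) (auto simp: g_zero g_add T_sum)

lemma g_sum_scale:
  assumes "\<And>i. i \<in> I \<Longrightarrow> u i \<in> T p" "w \<in> T p"
  shows "g p (\<Sum>i\<in>I. c i *\<^sub>R u i) w = (\<Sum>i\<in>I. c i * g p (u i) w)"
  using assms by (simp add: g_sum T_scale g_scale)

text \<open>The vectors of \<open>T p\<close> that equal their own expansion form a subspace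
  containing every \<open>u i\<close>, hence the whole span.\<close>

lemma orthonormal_expansion:
  assumes "finite I" "\<And>i. i \<in> I \<Longrightarrow> u i \<in> T p"
    and on: "\<And>i j. i \<in> I \<Longrightarrow> j \<in> I \<Longrightarrow> g p (u i) (u j) = (if i = j then 1 else 0)"
    and "v \<in> span (u ` I)"
  shows "v \<in> T p" "v = (\<Sum>i\<in>I. g p v (u i) *\<^sub>R u i)"
proof -
  let ?S = "{v \<in> T p. v = (\<Sum>i\<in>I. g p v (u i) *\<^sub>R u i)}"
  have "u ` I \<subseteq> ?S"
    using assms(1,2) by (auto simp: on if_distrib[of "\<lambda>c. c *\<^sub>R _"] cong: if_cong)
  moreover have "subspace ?S"
    by (rule subspaceI)
      (auto simp: zero_in_tangent_space T_add T_scale assms(2) g_zero g_add g_scale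
        scaleR_add_left sum.distrib simp flip: scaleR_scaleR scaleR_sum_right)
  ultimately have "span (u ` I) \<subseteq> ?S"
    by (rule span_minimal)
  then show "v \<in> T p" "v = (\<Sum>i\<in>I. g p v (u i) *\<^sub>R u i)"
    using assms(4) by blast+
qed

context
  fixes U X Y
  assumes U: "open U" and X: "vf U X" and Y: "vf U Y"
begin

lemma nab_vf: "vf U (nab X Y)"
  and nab_cong: "(\<And>q. q \<in> U \<Longrightarrow> X' q = X q) \<Longrightarrow> (\<And>q. q \<in> U \<Longrightarrow> Y' q = Y q) \<Longrightarrow> p \<in> U \<Longrightarrow>
    nab X' Y' p = nab X Y p"
  and nab_add1: "vf U Z \<Longrightarrow> p \<in> U \<Longrightarrow> nab (X + Z) Y p = nab X Y p + nab Z Y p"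
  and nab_add2: "vf U Z \<Longrightarrow> p \<in> U \<Longrightarrow> nab X (Y + Z) p = nab X Y p + nab X Z p"
  and nab_scale1: "smooth_fun A U f \<Longrightarrow> p \<in> U \<Longrightarrow> nab (\<lambda>q. f q *\<^sub>R X q) Y p = f p *\<^sub>R nab X Y p"
  and nab_scale2: "smooth_fun A U f \<Longrightarrow> p \<in> U \<Longrightarrow>
    nab X (\<lambda>q. f q *\<^sub>R Y q) p = X p f *\<^sub>R Y p + f p *\<^sub>R nab X Y p"
proof -
  have "connection A nab"
    using levi_civita by (simp add: levi_civita_def)
  note * = this[unfolded connection_def, rule_format, OF conjI[OF U conjI[OF X Y]]]
  show "vf U (nab X Y)" using * by blast
  show "nab X' Y' p = nab X Y p"
    if "\<And>q. q \<in> U \<Longrightarrow> X' q = X q" "\<And>q. q \<in> U \<Longrightarrow> Y' q = Y q" "p \<in> U"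
    using * that by blast
  show "nab (X + Z) Y p = nab X Y p + nab Z Y p" "nab X (Y + Z) p = nab X Y p + nab X Z p"
    if "vf U Z" "p \<in> U" using * that by blast+
  show "nab (\<lambda>q. f q *\<^sub>R X q) Y p = f p *\<^sub>R nab X Y p"
    "nab X (\<lambda>q. f q *\<^sub>R Y q) p = X p f *\<^sub>R Y p + f p *\<^sub>R nab X Y p"
    if "smooth_fun A U f" "p \<in> U" using * that by blast+
qed

lemma lie_bracket_nab: "p \<in> U \<Longrightarrow> lie_bracket A X Y p = nab X Y p - nab Y X p"
  using levi_civita U X Y by (auto simp: levi_civita_def)

lemma nab_metric: "vf U Z \<Longrightarrow> p \<in> U \<Longrightarrow>
    Z p (\<lambda>q. g q (X q) (Y q)) = g p (nab Z X p) (Y p) + g p (X p) (nab Z Y p)"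
  using levi_civita U X Y unfolding levi_civita_def by blast

end

lemma vf_add: "vf U X \<Longrightarrow> vf U Y \<Longrightarrow> vf U (X + Y)"
  by (rule vector_field_add[OF atlas])

lemma vf_scale: "smooth_fun A U f \<Longrightarrow> vf U X \<Longrightarrow> vf U (\<lambda>q. f q *\<^sub>R X q)"
  by (rule vector_field_scale[OF atlas])

lemma vf_cscale: "open U \<Longrightarrow> vf U X \<Longrightarrow> vf U (\<lambda>q. c *\<^sub>R X q)"
  by (rule vf_scale) (rule smooth_fun_const[OF atlas])

lemma nab_diff1:
  assumes U: "open U" and X: "vf U X" and Y: "vf U Y" and Z: "vf U Z" and p: "p \<in> U"
  shows "nab (\<lambda>q. X q - Y q) Z p = nab X Z p - nab Y Z p"
proof -
  note m = vf_cscale[OF U Y, of "-1"]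
  have "nab (\<lambda>q. X q - Y q) Z p = nab (X + (\<lambda>q. (-1) *\<^sub>R Y q)) Z p"
    by (rule nab_cong[OF U vf_add[OF X m] Z _ _ p]) auto
  also have "\<dots> = nab X Z p + nab (\<lambda>q. (-1) *\<^sub>R Y q) Z p"
    by (rule nab_add1[OF U X Z m p])
  finally show ?thesis
    using nab_scale1[OF U Y Z smooth_fun_const[OF atlas U, of "-1"] p] by simp
qed

lemma nab_diff2:
  assumes U: "open U" and X: "vf U X" and Y: "vf U Y" and Z: "vf U Z" and p: "p \<in> U"
  shows "nab Z (\<lambda>q. X q - Y q) p = nab Z X p - nab Z Y p"
proof -
  note m = vf_cscale[OF U Y, of "-1"]
  have "nab Z (\<lambda>q. X q - Y q) p = nab Z (X + (\<lambda>q. (-1) *\<^sub>R Y q)) p"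
    by (rule nab_cong[OF U Z vf_add[OF X m] _ _ p]) auto
  also have "\<dots> = nab Z X p + nab Z (\<lambda>q. (-1) *\<^sub>R Y q) p"
    by (rule nab_add2[OF U Z X m p])
  finally show ?thesis
    using nab_scale2[OF U Z Y smooth_fun_const[OF atlas U, of "-1"] p]
      tangent_const[OF vector_field_tangent[OF Z p] atlas] by simp
qed

lemma vf_diff: "open U \<Longrightarrow> vf U X \<Longrightarrow> vf U Y \<Longrightarrow> vf U (\<lambda>q. X q - Y q)"
  by (rule vector_field_cong[OF atlas _ vf_add[OF _ vf_cscale[of U Y "-1"]]]) auto

text \<open>By torsion-freeness the bracket is, on \<open>U\<close>, a difference of two fields that
  the connection already makes smooth.\<close>

lemma lie_bracket_vf:
  assumes "open U" "vf U X" "vf U Y"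
  shows "vf U (lie_bracket A X Y)"
  by (rule vector_field_cong[OF atlas _ vf_diff[OF assms(1) nab_vf[OF assms] nab_vf[OF assms(1,3,2)]]])
    (use assms in \<open>simp add: lie_bracket_nab\<close>)

lemma curvature_vf:
  assumes "open U" "vf U X" "vf U Y" "vf U Z"
  shows "vf U (curvature A nab X Y Z)"
  by (rule vector_field_cong[OF atlas, where X = "\<lambda>q. (nab X (nab Y Z) q - nab Y (nab X Z) q)
      - nab (lie_bracket A X Y) Z q"])
    (use assms in \<open>auto simp: curvature_def intro!: vf_diff nab_vf lie_bracket_vf\<close>)

lemma curvature_cong:
  assumes U: "open U" and f: "vf U X" "vf U Y" "vf U Z"
    and eq: "\<And>q. q \<in> U \<Longrightarrow> X' q = X q" "\<And>q. q \<in> U \<Longrightarrow> Y' q = Y q" "\<And>q. q \<in> U \<Longrightarrow> Z' q = Z q"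
    and p: "p \<in> U"
  shows "curvature A nab X' Y' Z' p = curvature A nab X Y Z p"
proof -
  have f': "vf U X'" "vf U Y'"
    using eq f by (auto intro: vector_field_cong[OF atlas])
  have "lie_bracket A X' Y' q = lie_bracket A X Y q" if "q \<in> U" for q
    using that nab_cong[OF U f(1,2) eq(1,2)] nab_cong[OF U f(2,1) eq(2,1)]
    by (simp add: lie_bracket_nab[OF U f(1,2)] lie_bracket_nab[OF U f'])
  then have "nab (lie_bracket A X' Y') Z' p = nab (lie_bracket A X Y) Z p"
    by (rule nab_cong[OF U lie_bracket_vf[OF U f(1,2)] f(3) _ eq(3) p])
  moreover have "nab X' (nab Y' Z') p = nab X (nab Y Z) p"
    by (rule nab_cong[OF U f(1) nab_vf[OF U f(2,3)] eq(1) nab_cong[OF U f(2,3) eq(2,3)] p])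
  moreover have "nab Y' (nab X' Z') p = nab Y (nab X Z) p"
    by (rule nab_cong[OF U f(2) nab_vf[OF U f(1,3)] eq(2) nab_cong[OF U f(1,3) eq(1,3)] p])
  ultimately show ?thesis
    by (simp add: curvature_def)
qed

section \<open>Symmetries and linearity of the curvature of vector fields\<close>

context
  fixes U X Y Z p
  assumes U: "open U" and X: "vf U X" and Y: "vf U Y" and Z: "vf U Z" and p: "p \<in> U"
begin

lemma curvature_anti: "curvature A nab X Y Z p = - curvature A nab Y X Z p"
proof -
  have "nab (lie_bracket A X Y) Z p = nab (\<lambda>q. (-1) *\<^sub>R lie_bracket A Y X q) Z p"
    by (rule nab_cong[OF U vf_cscale[OF U lie_bracket_vf[OF U Y X]] Z _ _ p])
      (simp_all add: lie_bracket_nab[OF U X Y] lie_bracket_nab[OF U Y X])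
  also have "\<dots> = - nab (lie_bracket A Y X) Z p"
    using nab_scale1[OF U lie_bracket_vf[OF U Y X] Z smooth_fun_const[OF atlas U, of "-1"] p] by simp
  finally show ?thesis by (simp add: curvature_def)
qed

lemma curvature_add1:
  assumes V: "vf U V"
  shows "curvature A nab (X + V) Y Z p = curvature A nab X Y Z p + curvature A nab V Y Z p"
proof -
  note XV = vf_add[OF X V]
  have 1: "nab Y (nab (X + V) Z) p = nab Y (nab X Z) p + nab Y (nab V Z) p"
    using nab_cong[OF U Y vf_add[OF nab_vf[OF U X Z] nab_vf[OF U V Z]], of Y "nab (X + V) Z" p] p
      nab_add1[OF U X Z V] nab_add2[OF U Y nab_vf[OF U X Z] nab_vf[OF U V Z] p] by simp
  have "nab (lie_bracket A (X + V) Y) Z p = nab (lie_bracket A X Y + lie_bracket A V Y) Z p"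
    by (rule nab_cong[OF U vf_add[OF lie_bracket_vf[OF U X Y] lie_bracket_vf[OF U V Y]] Z _ _ p])
      (simp_all add: lie_bracket_nab[OF U XV Y] lie_bracket_nab[OF U X Y] lie_bracket_nab[OF U V Y]
        nab_add1[OF U X Y V] nab_add2[OF U Y X V])
  also have "\<dots> = nab (lie_bracket A X Y) Z p + nab (lie_bracket A V Y) Z p"
    by (rule nab_add1[OF U lie_bracket_vf[OF U X Y] Z lie_bracket_vf[OF U V Y] p])
  finally show ?thesis
    by (simp add: curvature_def 1 nab_add1[OF U X nab_vf[OF U Y Z] V p])
qed

text \<open>Since \<open>[f X, Y] = f [X, Y] - (Y f) X\<close>, the bracket term contains
  \<open>Y p f\<close> times \<open>nab X Z p\<close>, which cancels the same term arising from the
  derivative of \<open>f\<close> in \<open>nab Y (nab (f X) Z)\<close>.\<close>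

lemma curvature_scale1:
  assumes f: "smooth_fun A U f"
  shows "curvature A nab (\<lambda>q. f q *\<^sub>R X q) Y Z p = f p *\<^sub>R curvature A nab X Y Z p"
proof -
  note fX = vf_scale[OF f X]
  have Yf: "smooth_fun A U (\<lambda>q. - (Y q f))"
    using smooth_fun_mult[OF atlas U smooth_fun_const[OF atlas U, of "-1"]
        vector_field_smooth[OF Y U order_refl f]] by simp
  have 1: "nab Y (nab (\<lambda>q. f q *\<^sub>R X q) Z) p = Y p f *\<^sub>R nab X Z p + f p *\<^sub>R nab Y (nab X Z) p"
    using nab_cong[OF U Y vf_scale[OF f nab_vf[OF U X Z]], of Y "nab (\<lambda>q. f q *\<^sub>R X q) Z" p] p
      nab_scale1[OF U X Z f] nab_scale2[OF U Y nab_vf[OF U X Z] f p] by simp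
  note v = vf_scale[OF f lie_bracket_vf[OF U X Y]] vf_scale[OF Yf X]
  have "nab (lie_bracket A (\<lambda>q. f q *\<^sub>R X q) Y) Z p =
      nab ((\<lambda>q. f q *\<^sub>R lie_bracket A X Y q) + (\<lambda>q. (- (Y q f)) *\<^sub>R X q)) Z p"
    by (rule nab_cong[OF U vf_add[OF v] Z _ _ p])
      (simp_all add: lie_bracket_nab[OF U fX Y] lie_bracket_nab[OF U X Y]
        nab_scale1[OF U X Y f] nab_scale2[OF U Y X f] scaleR_diff_right)
  also have "\<dots> = f p *\<^sub>R nab (lie_bracket A X Y) Z p - Y p f *\<^sub>R nab X Z p"
    using nab_add1[OF U v(1) Z v(2) p] nab_scale1[OF U lie_bracket_vf[OF U X Y] Z f p]
      nab_scale1[OF U X Z Yf p] by simp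
  finally show ?thesis
    by (simp add: curvature_def 1 nab_scale1[OF U X nab_vf[OF U Y Z] f p] scaleR_diff_right)
qed

lemma curvature_add3:
  assumes V: "vf U V"
  shows "curvature A nab X Y (Z + V) p = curvature A nab X Y Z p + curvature A nab X Y V p"
proof -
  have "nab X (nab Y (Z + V)) p = nab X (nab Y Z) p + nab X (nab Y V) p"
    if X: "vf U X" and Y: "vf U Y" for X Y
    using nab_cong[OF U X vf_add[OF nab_vf[OF U Y Z] nab_vf[OF U Y V]], of X "nab Y (Z + V)" p] p
      nab_add2[OF U Y Z V] nab_add2[OF U X nab_vf[OF U Y Z] nab_vf[OF U Y V] p] by simp
  then show ?thesis
    by (simp add: curvature_def X Y nab_add2[OF U lie_bracket_vf[OF U X Y] Z V p])
qed

text \<open>Second derivatives of \<open>f\<close> appear here; their commutator is the derivative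
  of \<open>f\<close> along \<open>lie_bracket A X Y\<close>, which the bracket term removes. The
  first-order terms are symmetric in \<open>X\<close> and \<open>Y\<close> and drop out.\<close>

lemma curvature_scale3:
  assumes f: "smooth_fun A U f"
  shows "curvature A nab X Y (\<lambda>q. f q *\<^sub>R Z q) p = f p *\<^sub>R curvature A nab X Y Z p"
proof -
  have *: "nab X (nab Y (\<lambda>q. f q *\<^sub>R Z q)) p = X p (\<lambda>q. Y q f) *\<^sub>R Z p + Y p f *\<^sub>R nab X Z p
      + X p f *\<^sub>R nab Y Z p + f p *\<^sub>R nab X (nab Y Z) p"
    if X: "vf U X" and Y: "vf U Y" for X Y
  proof -
    note Yf = vector_field_smooth[OF Y U order_refl f]
    note v = vf_scale[OF Yf Z] vf_scale[OF f nab_vf[OF U Y Z]]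
    have "nab X (nab Y (\<lambda>q. f q *\<^sub>R Z q)) p =
        nab X ((\<lambda>q. Y q f *\<^sub>R Z q) + (\<lambda>q. f q *\<^sub>R nab Y Z q)) p"
      by (rule nab_cong[OF U X vf_add[OF v] _ _ p]) (simp_all add: nab_scale2[OF U Y Z f])
    then show ?thesis
      by (simp add: nab_add2[OF U X v p] nab_scale2[OF U X Z Yf p]
          nab_scale2[OF U X nab_vf[OF U Y Z] f p])
  qed
  have "lie_bracket A X Y p f = X p (\<lambda>q. Y q f) - Y p (\<lambda>q. X q f)"
    using smooth_nearI[OF U p f] by (simp add: lie_bracket_def)
  then show ?thesis
    by (simp add: curvature_def *[OF X Y] *[OF Y X] nab_scale2[OF U lie_bracket_vf[OF U X Y] Z f p]
        scaleR_diff_right scaleR_diff_left)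
qed

text \<open>The derivative of \<open>?G\<close> along \<open>lie_bracket A X Y\<close> is computed
  twice, as a commutator of derivatives and by metric compatibility. In the commutator the products
  of two first covariant derivatives cancel, and what remains is the claim.\<close>

lemma curvature_skew:
  assumes V: "vf U V"
  shows "g p (curvature A nab X Y Z p) (V p) = - g p (curvature A nab X Y V p) (Z p)"
proof -
  let ?G = "\<lambda>q. g q (Z q) (V q)"
  note sG = smooth_nearI[OF U p g_smooth[OF U Z V]]
  have *: "X p (\<lambda>q. Y q ?G) = g p (nab X (nab Y Z) p) (V p) + g p (nab Y Z p) (nab X V p)
      + g p (nab X Z p) (nab Y V p) + g p (Z p) (nab X (nab Y V) p)"
    if X: "vf U X" and Y: "vf U Y" for X Y
  proof -
    note n = nab_vf[OF U Y Z] nab_vf[OF U Y V]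
    have "X p (\<lambda>q. Y q ?G) = X p (\<lambda>q. g q (nab Y Z q) (V q) + g q (Z q) (nab Y V q))"
      by (rule tangent_cong[OF vector_field_tangent[OF X p] atlas U p])
        (rule nab_metric[OF U Z V Y])
    also have "\<dots> = X p (\<lambda>q. g q (nab Y Z q) (V q)) + X p (\<lambda>q. g q (Z q) (nab Y V q))"
      by (intro tangent_add[OF vector_field_tangent[OF X p]] smooth_nearI[OF U p] g_smooth U n V Z)
    finally show ?thesis
      by (simp add: nab_metric[OF U n(1) V X p] nab_metric[OF U Z n(2) X p])
  qed
  have "lie_bracket A X Y p ?G = X p (\<lambda>q. Y q ?G) - Y p (\<lambda>q. X q ?G)"
    using sG by (simp add: lie_bracket_def)
  moreover have "lie_bracket A X Y p ?G =
      g p (nab (lie_bracket A X Y) Z p) (V p) + g p (Z p) (nab (lie_bracket A X Y) V p)"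
    by (rule nab_metric[OF U Z V lie_bracket_vf[OF U X Y] p])
  moreover have "nab X (nab Y W) p \<in> T p" "nab Y (nab X W) p \<in> T p" "nab (lie_bracket A X Y) W p \<in> T p"
    if "vf U W" for W
    using that U X Y p by (auto intro!: vector_field_tangent[OF _ p] nab_vf lie_bracket_vf)
  ultimately show ?thesis
    using *[OF X Y] *[OF Y X] Z V vector_field_tangent[OF Z p] vector_field_tangent[OF V p]
    by (simp add: curvature_def g_diff T_diff g_sym[of "Z p"])
qed

end

section \<open>Traces in an orthonormal frame\<close>

text \<open>Linearity is assumed on \<open>T p\<close> alone because the metric and the curvature
  are known to be linear only on tangent vectors.\<close>

lemma linear_sum_on:
  assumes lin: "\<And>x y a b. x \<in> T p \<Longrightarrow> y \<in> T p \<Longrightarrow> L (a *\<^sub>R x + b *\<^sub>R y) = a *\<^sub>R L x + b *\<^sub>R (L y :: 'v::real_vector)"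
    and "\<And>i. i \<in> K \<Longrightarrow> w i \<in> T p"
  shows "L (\<Sum>i\<in>K. c i *\<^sub>R w i) = (\<Sum>i\<in>K. c i *\<^sub>R L (w i))"
proof -
  have 0: "L 0 = 0"
    using lin[OF zero_in_tangent_space zero_in_tangent_space, of 0 0] by simp
  show ?thesis
    using assms(2)
  proof (induction K rule: infinite_finite_induct)
    case (insert i K)
    have "(\<Sum>i\<in>K. c i *\<^sub>R w i) \<in> T p"
      using insert by (intro T_sum T_scale) auto
    with insert show ?case
      using lin[of "w i" "\<Sum>i\<in>K. c i *\<^sub>R w i" "c i" 1] by (simp del: plus_fun_apply)
  qed (use 0 in simp_all)
qed

context
  fixes I :: "'i set" and u :: "'i \<Rightarrow> 'a tvec" and p :: 'a
  assumes I: "finite I" and u: "\<And>i. i \<in> I \<Longrightarrow> u i \<in> T p"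
    and on: "\<And>i j. i \<in> I \<Longrightarrow> j \<in> I \<Longrightarrow> g p (u i) (u j) = (if i = j then 1 else 0)"
    and sp: "T p \<subseteq> span (u ` I)"
begin

lemma expansion: "v \<in> T p \<Longrightarrow> v = (\<Sum>i\<in>I. g p v (u i) *\<^sub>R u i)"
  using orthonormal_expansion[OF I u on] sp by blast

text \<open>\<open>trace_on\<close> uses an unspecified basis \<open>E\<close>. Once each
  \<open>b\<close> is expanded in the family \<open>u\<close> and the sums are exchanged, the
  coordinates of \<open>L (u i)\<close> in \<open>E\<close> recombine to \<open>L (u i)\<close>
  itself, and \<open>E\<close> disappears.\<close>

lemma trace_on_orthonormal:
  assumes lin: "\<And>x y a b. x \<in> T p \<Longrightarrow> y \<in> T p \<Longrightarrow> L (a *\<^sub>R x + b *\<^sub>R y) = a *\<^sub>R L x + b *\<^sub>R L y"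
    and LT: "\<And>x. x \<in> T p \<Longrightarrow> L x \<in> T p"
  shows "trace_on (T p) L = (\<Sum>i\<in>I. g p (L (u i)) (u i))"
proof -
  define E where "E = (SOME E. independent E \<and> span E = T p)"
  have ex: "\<exists>E. independent E \<and> span E = T p"
  proof -
    obtain B where B: "B \<subseteq> T p" "independent B" "T p \<subseteq> span B" "card B = dim (T p)"
      by (rule basis_exists)
    then have "span B = T p"
      by (intro antisym span_minimal subspace_tangent_space[OF atlas])
    with B show ?thesis by blast
  qed
  have E: "independent E" "span E = T p"
    using someI_ex[OF ex] unfolding E_def by (rule conjunct1, rule conjunct2)
  have ET: "b \<in> T p" if "b \<in> E" for b
    using that E(2) span_base[of b E] by simp
  \<comment> \<open>An independent set inside the span of the finitely many \<open>u i\<close> is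
    finite; this is what allows \<open>L (u i)\<close> to be recovered by summing over all of
    \<open>E\<close>.\<close>
  have fin: "finite E"
    using independent_span_bound[of "u ` I" E] I E(1) ET sp by (auto simp: subset_iff)
  let ?r = "representation E"
  have "?r (L b) b = (\<Sum>i\<in>I. g p b (u i) * ?r (L (u i)) b)" if "b \<in> E" for b
  proof -
    have "L b = L (\<Sum>i\<in>I. g p b (u i) *\<^sub>R u i)"
      by (rule arg_cong[OF expansion[OF ET[OF that]]])
    also have "\<dots> = (\<Sum>i\<in>I. g p b (u i) *\<^sub>R L (u i))"
      by (rule linear_sum_on[OF lin]) (use u in auto)
    finally have "?r (L b) = (\<lambda>c. \<Sum>i\<in>I. ?r (g p b (u i) *\<^sub>R L (u i)) c)"
      using E u by (simp add: representation_sum LT T_scale)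
    then show ?thesis
      using E u by (simp add: representation_scale LT)
  qed
  then have "trace_on (T p) L = (\<Sum>b\<in>E. \<Sum>i\<in>I. g p b (u i) * ?r (L (u i)) b)"
    unfolding trace_on_def Let_def E_def[symmetric] by simp
  also have "\<dots> = (\<Sum>i\<in>I. \<Sum>b\<in>E. ?r (L (u i)) b * g p b (u i))"
    by (subst sum.swap) (simp add: mult.commute)
  also have "\<dots> = (\<Sum>i\<in>I. g p (L (u i)) (u i))"
  proof (rule sum.cong[OF refl])
    fix i assume i: "i \<in> I"
    have "(\<Sum>b\<in>E. ?r (L (u i)) b *\<^sub>R b) = L (u i)"
      using sum_representation_eq[OF E(1) _ fin order_refl, of "L (u i)"] LT[OF u[OF i]] E(2) by simp
    then show "(\<Sum>b\<in>E. ?r (L (u i)) b * g p b (u i)) = g p (L (u i)) (u i)"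
      using g_sum_scale[of E "\<lambda>b. b" p "u i" "?r (L (u i))"] ET u[OF i] by simp
  qed
  finally show ?thesis .
qed

text \<open>Basis independence of the metric trace, for use with the arbitrary basis in
  \<open>scalar_curvature\<close>. Expanding \<open>b\<close> in both slots, the sum of
  \<open>g p b (u i) * g p b (u j)\<close> over \<open>E\<close> is \<open>g p (u i) (u j)\<close>,
  because \<open>E\<close> is orthonormal and spans \<open>T p\<close>.\<close>

lemma bilinear_trace_orthonormal:
  assumes l1: "\<And>x y z a b. x \<in> T p \<Longrightarrow> y \<in> T p \<Longrightarrow> z \<in> T p \<Longrightarrow> H (a *\<^sub>R x + b *\<^sub>R y) z = a * H x z + b * H y z"
    and l2: "\<And>x y z a b. x \<in> T p \<Longrightarrow> y \<in> T p \<Longrightarrow> z \<in> T p \<Longrightarrow> H z (a *\<^sub>R x + b *\<^sub>R y) = a * H z x + b * H z y"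
    and E: "finite E" "span E = T p"
      "\<And>b c. b \<in> E \<Longrightarrow> c \<in> E \<Longrightarrow> g p b c = (if b = c then 1 else 0)"
  shows "(\<Sum>b\<in>E. H b b) = (\<Sum>i\<in>I. H (u i) (u i))"
proof -
  have ET: "b \<in> T p" if "b \<in> E" for b
    using that E(2) span_base[of b E] by simp
  have "H b b = (\<Sum>i\<in>I. \<Sum>j\<in>I. g p b (u i) * (g p b (u j) * H (u i) (u j)))" if b: "b \<in> E" for b
  proof -
    have "H b b = H (\<Sum>i\<in>I. g p b (u i) *\<^sub>R u i) b"
      by (simp flip: expansion[OF ET[OF b]])
    also have "\<dots> = (\<Sum>i\<in>I. g p b (u i) * H (u i) b)"
      using linear_sum_on[of p "\<lambda>x. H x b" I u "\<lambda>i. g p b (u i)"] l1 u ET[OF b] by simp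
    also have "\<dots> = (\<Sum>i\<in>I. g p b (u i) * (\<Sum>j\<in>I. g p b (u j) * H (u i) (u j)))"
    proof (rule sum.cong[OF refl])
      fix i assume i: "i \<in> I"
      have "H (u i) b = H (u i) (\<Sum>j\<in>I. g p b (u j) *\<^sub>R u j)"
        by (simp flip: expansion[OF ET[OF b]])
      also have "\<dots> = (\<Sum>j\<in>I. g p b (u j) * H (u i) (u j))"
        using linear_sum_on[of p "H (u i)" I u "\<lambda>j. g p b (u j)"] l2 u i by simp
      finally show "g p b (u i) * H (u i) b = g p b (u i) * (\<Sum>j\<in>I. g p b (u j) * H (u i) (u j))"
        by simp
    qed
    finally show ?thesis by (simp add: sum_distrib_left)
  qed
  then have "(\<Sum>b\<in>E. H b b) = (\<Sum>b\<in>E. \<Sum>i\<in>I. \<Sum>j\<in>I. g p b (u i) * (g p b (u j) * H (u i) (u j)))"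
    by simp
  also have "\<dots> = (\<Sum>i\<in>I. \<Sum>j\<in>I. \<Sum>b\<in>E. g p b (u i) * (g p b (u j) * H (u i) (u j)))"
    by (subst sum.swap, rule sum.cong[OF refl], rule sum.swap)
  also have "\<dots> = (\<Sum>i\<in>I. \<Sum>j\<in>I. (if i = j then 1 else 0) * H (u i) (u j))"
  proof (intro sum.cong refl)
    fix i j assume ij: "i \<in> I" "j \<in> I"
    have "u i = (\<Sum>b\<in>E. g p (u i) b *\<^sub>R b)"
      by (rule orthonormal_expansion(2)[of E "\<lambda>b. b" p "u i"]) (use E ET u[OF ij(1)] in simp_all)
    then have "g p (u i) (u j) = g p (\<Sum>b\<in>E. g p (u i) b *\<^sub>R b) (u j)"
      by (rule arg_cong)
    also have "\<dots> = (\<Sum>b\<in>E. g p (u i) b * g p b (u j))"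
      using g_sum_scale[of E "\<lambda>b. b" p "u j" "g p (u i)"] ET u[OF ij(2)] by simp
    also have "\<dots> = (\<Sum>b\<in>E. g p b (u i) * g p b (u j))"
      using ET u[OF ij(1)] by (simp add: g_sym)
    finally show "(\<Sum>b\<in>E. g p b (u i) * (g p b (u j) * H (u i) (u j))) =
        (if i = j then 1 else 0) * H (u i) (u j)"
      using on[OF ij] by (simp add: sum_distrib_right mult.assoc)
  qed
  also have "\<dots> = (\<Sum>i\<in>I. H (u i) (u i))"
    using I by (simp add: if_distrib[of "\<lambda>x. x * _"] cong: if_cong)
  finally show ?thesis .
qed

end

end

section \<open>Tensoriality of the curvature and its traces in a local orthonormal frame\<close>

text \<open>The index type is left general so that two frames indexed by naturals can later be
  joined along a disjoint sum.\<close>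

locale orthonormal_framed = riemannian_manifold A g nab
  for A :: "('a::{t2_space,second_countable_topology}, 'e::euclidean_space) atlas" and g nab +
  fixes U :: "'a set" and I :: "'i set" and G :: "'i \<Rightarrow> 'a vfield"
  assumes U: "open U" and I: "finite I" and G: "\<And>i. i \<in> I \<Longrightarrow> vf U (G i)"
    and orthonormal: "\<And>p i j. p \<in> U \<Longrightarrow> i \<in> I \<Longrightarrow> j \<in> I \<Longrightarrow> g p (G i p) (G j p) = (if i = j then 1 else 0)"
    and spanning: "\<And>p. p \<in> U \<Longrightarrow> T p \<subseteq> span ((\<lambda>i. G i p) ` I)"
begin

lemma G_T: "p \<in> U \<Longrightarrow> i \<in> I \<Longrightarrow> G i p \<in> T p"
  using vector_field_tangent G by blast

lemma frame_expansion: "p \<in> U \<Longrightarrow> v \<in> T p \<Longrightarrow> v = (\<Sum>i\<in>I. g p v (G i p) *\<^sub>R G i p)"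
  by (rule expansion[OF I]) (auto simp: G_T orthonormal spanning)

lemma field_expansion:
  assumes "open V" "V \<subseteq> U" "vf V X" "q \<in> V"
  shows "X q = (\<Sum>i\<in>I. (\<lambda>q. g q (X q) (G i q) *\<^sub>R G i q)) q"
  unfolding sum_fun_apply[where x = q]
  by (rule frame_expansion) (use assms vector_field_tangent[OF assms(3,4)] in auto)

lemma coefficient_smooth:
  assumes "open V" "V \<subseteq> U" "vf V X" "i \<in> I"
  shows "smooth_fun A V (\<lambda>q. g q (X q) (G i q))"
  using assms G vector_field_subset by (intro g_smooth) blast+

text \<open>The frame coefficients of \<open>X\<close> are smooth functions and come out of the
  first slot undifferentiated. The zero field, which starts the induction, is treated as 0 times
  \<open>Y\<close>.\<close>

lemma nab_expansion:
  assumes X: "vf U X" and Y: "vf U Y" and p: "p \<in> U"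
  shows "nab X Y p = (\<Sum>i\<in>I. g p (X p) (G i p) *\<^sub>R nab (G i) Y p)"
proof -
  let ?X = "\<lambda>i q. g q (X q) (G i q) *\<^sub>R G i q"
  have v: "vf U (?X i)" if "i \<in> I" for i
    using that by (intro vf_scale coefficient_smooth U X G) auto
  have 0: "nab 0 Y p = 0"
  proof -
    have "nab 0 Y p = nab (\<lambda>q. 0 *\<^sub>R Y q) Y p"
      by (rule nab_cong[OF U vf_cscale[OF U Y] Y _ _ p]) auto
    then show ?thesis
      using nab_scale1[OF U Y Y smooth_fun_const[OF atlas U, of 0] p] by simp
  qed
  have "nab (sum ?X K) Y p = (\<Sum>i\<in>K. g p (X p) (G i p) *\<^sub>R nab (G i) Y p)" if "K \<subseteq> I" for K
    using finite_subset[OF that I] that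
  proof (induction K rule: finite_induct)
    case (insert i K)
    then have "vf U (sum ?X K)"
      using v by (intro vector_field_sum[OF atlas]) auto
    then show ?case
      using insert v nab_add1[OF U v Y _ p] nab_scale1[OF U G Y coefficient_smooth[OF U order_refl X] p]
      by (simp del: plus_fun_apply)
  qed (simp add: 0)
  moreover have "nab X Y p = nab (sum ?X I) Y p"
    using v by (intro nab_cong[OF U _ Y _ _ p] vector_field_sum[OF atlas])
      (auto intro: field_expansion U X)
  ultimately show ?thesis by simp
qed

text \<open>Stated on an arbitrary open \<open>V\<close> inside \<open>U\<close> because
  tensoriality has to compare fields defined on different neighbourhoods.\<close>

lemma curvature_expansion1:
  assumes V: "open V" "V \<subseteq> U" and X: "vf V X" and Y: "vf V Y" and Z: "vf V Z" and p: "p \<in> V"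
  shows "curvature A nab X Y Z p = (\<Sum>i\<in>I. g p (X p) (G i p) *\<^sub>R curvature A nab (G i) Y Z p)"
proof -
  let ?X = "\<lambda>i q. g q (X q) (G i q) *\<^sub>R G i q"
  have G': "vf V (G i)" if "i \<in> I" for i
    using that G V vector_field_subset by blast
  have v: "vf V (?X i)" if "i \<in> I" for i
    using that by (intro vf_scale coefficient_smooth V X G')
  have 0: "curvature A nab 0 Y Z p = 0"
  proof -
    have "curvature A nab 0 Y Z p = curvature A nab (\<lambda>q. 0 *\<^sub>R Y q) Y Z p"
      by (rule curvature_cong[OF V(1) vf_cscale[OF V(1) Y] Y Z _ _ _ p]) auto
    then show ?thesis
      using curvature_scale1[OF V(1) Y Y Z p smooth_fun_const[OF atlas V(1), of 0]] by simp
  qed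
  have "curvature A nab (sum ?X K) Y Z p = (\<Sum>i\<in>K. g p (X p) (G i p) *\<^sub>R curvature A nab (G i) Y Z p)"
    if "K \<subseteq> I" for K
    using finite_subset[OF that I] that
  proof (induction K rule: finite_induct)
    case (insert i K)
    then have "vf V (sum ?X K)"
      using v by (intro vector_field_sum[OF atlas]) auto
    then show ?case
      using insert v curvature_add1[OF V(1) v Y Z p]
        curvature_scale1[OF V(1) G' Y Z p coefficient_smooth[OF V X]]
      by (simp del: plus_fun_apply)
  qed (simp add: 0)
  moreover have "curvature A nab X Y Z p = curvature A nab (sum ?X I) Y Z p"
    using v by (intro curvature_cong[OF V(1) _ Y Z _ _ _ p] vector_field_sum[OF atlas])
      (auto intro: field_expansion[OF V X])
  ultimately show ?thesis by simp
qed

lemma curvature_expansion3: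
  assumes V: "open V" "V \<subseteq> U" and X: "vf V X" and Y: "vf V Y" and Z: "vf V Z" and p: "p \<in> V"
  shows "curvature A nab X Y Z p = (\<Sum>i\<in>I. g p (Z p) (G i p) *\<^sub>R curvature A nab X Y (G i) p)"
proof -
  let ?Z = "\<lambda>i q. g q (Z q) (G i q) *\<^sub>R G i q"
  have G': "vf V (G i)" if "i \<in> I" for i
    using that G V vector_field_subset by blast
  have v: "vf V (?Z i)" if "i \<in> I" for i
    using that by (intro vf_scale coefficient_smooth V Z G')
  have 0: "curvature A nab X Y 0 p = 0"
  proof -
    have "curvature A nab X Y 0 p = curvature A nab X Y (\<lambda>q. 0 *\<^sub>R Y q) p"
      by (rule curvature_cong[OF V(1) X Y vf_cscale[OF V(1) Y] _ _ _ p]) auto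
    then show ?thesis
      using curvature_scale3[OF V(1) X Y Y p smooth_fun_const[OF atlas V(1), of 0]] by simp
  qed
  have "curvature A nab X Y (sum ?Z K) p = (\<Sum>i\<in>K. g p (Z p) (G i p) *\<^sub>R curvature A nab X Y (G i) p)"
    if "K \<subseteq> I" for K
    using finite_subset[OF that I] that
  proof (induction K rule: finite_induct)
    case (insert i K)
    then have "vf V (sum ?Z K)"
      using v by (intro vector_field_sum[OF atlas]) auto
    then show ?case
      using insert v curvature_add3[OF V(1) X Y v p]
        curvature_scale3[OF V(1) X Y G' p coefficient_smooth[OF V Z]]
      by (simp del: plus_fun_apply)
  qed (simp add: 0)
  moreover have "curvature A nab X Y Z p = curvature A nab X Y (sum ?Z I) p"
    using v by (intro curvature_cong[OF V(1) X Y _ _ _ _ p] vector_field_sum[OF atlas])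
      (auto intro: field_expansion[OF V Z])
  ultimately show ?thesis by simp
qed

text \<open>On a common neighbourhood inside \<open>U\<close> the fields are replaced one at a time.
  Frame expansion handles the first and third slots; antisymmetry moves the second slot to the
  first.\<close>

lemma curvature_tensorial:
  assumes p: "p \<in> U"
    and V: "open V" "p \<in> V" "vf V X" "vf V Y" "vf V Z"
    and V': "open V'" "p \<in> V'" "vf V' X'" "vf V' Y'" "vf V' Z'"
    and eq: "X p = X' p" "Y p = Y' p" "Z p = Z' p"
  shows "curvature A nab X Y Z p = curvature A nab X' Y' Z' p"
proof -
  define O' where "O' = U \<inter> V \<inter> V'"
  have O': "open O'" "O' \<subseteq> U" "p \<in> O'"
    using U p V V' by (auto simp: O'_def)
  have v: "vf O' X" "vf O' Y" "vf O' Z" "vf O' X'" "vf O' Y'" "vf O' Z'"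
    using V V' by (auto simp: O'_def intro: vector_field_subset)
  have 1: "curvature A nab X Y Z p = curvature A nab X' Y Z p"
    if v: "vf O' X" "vf O' X'" "vf O' Y" "vf O' Z" and "X p = X' p" for X X' Y Z
    using that curvature_expansion1[OF O'(1,2) _ v(3,4) O'(3), of X]
      curvature_expansion1[OF O'(1,2) _ v(3,4) O'(3), of X'] by simp
  have "curvature A nab X Y Z p = curvature A nab X' Y Z p"
    by (rule 1) (use v eq in auto)
  also have "\<dots> = - curvature A nab Y X' Z p"
    by (rule curvature_anti[OF O'(1) v(4,2,3) O'(3)])
  also have "\<dots> = - curvature A nab Y' X' Z p"
    using 1[of Y Y' X' Z] v eq by simp
  also have "\<dots> = curvature A nab X' Y' Z p"
    by (simp add: curvature_anti[OF O'(1) v(4,5,3) O'(3)])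
  also have "\<dots> = curvature A nab X' Y' Z' p"
    using curvature_expansion3[OF O'(1,2) v(4,5,3) O'(3)]
      curvature_expansion3[OF O'(1,2) v(4,5,6) O'(3)] eq by simp
  finally show ?thesis .
qed

text \<open>Makes the definite description in \<open>curvature_at\<close> meaningful: by
  tensoriality the value fits all local extensions, and the given fields are one such extension, so
  no other value fits.\<close>

lemma curvature_at_eq:
  assumes "p \<in> U" "open V" "p \<in> V" "vf V X" "vf V Y" "vf V Z"
  shows "curvature_at A nab p (X p) (Y p) (Z p) = curvature A nab X Y Z p"
  unfolding curvature_at_def
proof (rule the_equality)
  show "\<forall>U' X' Y' Z'. open U' \<and> p \<in> U' \<and> vf U' X' \<and> vf U' Y' \<and> vf U' Z' \<and>
      X' p = X p \<and> Y' p = Y p \<and> Z' p = Z p \<longrightarrow> curvature A nab X' Y' Z' p = curvature A nab X Y Z p"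
    using curvature_tensorial[OF assms(1)] assms by blast
qed (use assms in blast)

text \<open>Combining the frame fields with the constant coefficients of \<open>v\<close> gives a
  field on all of \<open>U\<close>, through which identities for fields pass to
  \<open>curvature_at\<close>.\<close>

lemma field_extension:
  assumes p: "p \<in> U" and v: "v \<in> T p"
  obtains X where "vf U X" "X p = v"
proof
  let ?X = "\<Sum>i\<in>I. (\<lambda>q. g p v (G i p) *\<^sub>R G i q)"
  show "vf U ?X"
    by (intro vector_field_sum[OF atlas] vf_cscale U G)
  show "?X p = v"
    by (simp add: sum_fun_apply flip: frame_expansion[OF p v])
qed

context
  fixes p assumes p: "p \<in> U"
begin

lemma curvature_at_T:
  assumes "u \<in> T p" "v \<in> T p" "w \<in> T p"
  shows "curvature_at A nab p u v w \<in> T p"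
proof -
  obtain X where f1: "vf U X" "X p = u"
    by (rule field_extension[OF p assms(1)])
  obtain Y where f2: "vf U Y" "Y p = v"
    by (rule field_extension[OF p assms(2)])
  obtain Z where f3: "vf U Z" "Z p = w"
    by (rule field_extension[OF p assms(3)])
  note f = f1 f2 f3
  show ?thesis
    using curvature_at_eq[OF p U p f(1,3,5)] vector_field_tangent[OF curvature_vf[OF U f(1,3,5)] p] f
    by simp
qed

lemma curvature_at_lin1:
  assumes "u \<in> T p" "u' \<in> T p" "v \<in> T p" "w \<in> T p"
  shows "curvature_at A nab p (a *\<^sub>R u + b *\<^sub>R u') v w =
    a *\<^sub>R curvature_at A nab p u v w + b *\<^sub>R curvature_at A nab p u' v w"
proof -
  obtain X where f1: "vf U X" "X p = u"
    by (rule field_extension[OF p assms(1)])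
  obtain X' where f2: "vf U X'" "X' p = u'"
    by (rule field_extension[OF p assms(2)])
  obtain Y where f3: "vf U Y" "Y p = v"
    by (rule field_extension[OF p assms(3)])
  obtain Z where f4: "vf U Z" "Z p = w"
    by (rule field_extension[OF p assms(4)])
  note f = f1 f2 f3 f4
  note c = vf_cscale[OF U f(1), of a] vf_cscale[OF U f(3), of b]
  show ?thesis
    using curvature_at_eq[OF p U p vf_add[OF c] f(5,7)] curvature_at_eq[OF p U p f(1,5,7)]
      curvature_at_eq[OF p U p f(3,5,7)] curvature_add1[OF U c(1) f(5,7) p c(2)]
      curvature_scale1[OF U f(1,5,7) p smooth_fun_const[OF atlas U]]
      curvature_scale1[OF U f(3,5,7) p smooth_fun_const[OF atlas U]]
    by (simp add: f)
qed

lemma curvature_at_anti: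
  assumes "u \<in> T p" "v \<in> T p" "w \<in> T p"
  shows "curvature_at A nab p u v w = - curvature_at A nab p v u w"
proof -
  obtain X where f1: "vf U X" "X p = u"
    by (rule field_extension[OF p assms(1)])
  obtain Y where f2: "vf U Y" "Y p = v"
    by (rule field_extension[OF p assms(2)])
  obtain Z where f3: "vf U Z" "Z p = w"
    by (rule field_extension[OF p assms(3)])
  note f = f1 f2 f3
  show ?thesis
    using curvature_at_eq[OF p U p f(1,3,5)] curvature_at_eq[OF p U p f(3,1,5)]
      curvature_anti[OF U f(1,3,5) p] by (simp add: f)
qed

lemma curvature_at_lin2:
  assumes "u \<in> T p" "v \<in> T p" "v' \<in> T p" "w \<in> T p"
  shows "curvature_at A nab p u (a *\<^sub>R v + b *\<^sub>R v') w =
    a *\<^sub>R curvature_at A nab p u v w + b *\<^sub>R curvature_at A nab p u v' w"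
  using assms curvature_at_anti[of u "a *\<^sub>R v + b *\<^sub>R v'" w] curvature_at_anti[of u v w]
    curvature_at_anti[of u v' w]
  by (simp add: curvature_at_lin1 T_add T_scale)

lemma curvature_at_lin3:
  assumes "u \<in> T p" "v \<in> T p" "w \<in> T p" "w' \<in> T p"
  shows "curvature_at A nab p u v (a *\<^sub>R w + b *\<^sub>R w') =
    a *\<^sub>R curvature_at A nab p u v w + b *\<^sub>R curvature_at A nab p u v w'"
proof -
  obtain X where f1: "vf U X" "X p = u"
    by (rule field_extension[OF p assms(1)])
  obtain Y where f2: "vf U Y" "Y p = v"
    by (rule field_extension[OF p assms(2)])
  obtain Z where f3: "vf U Z" "Z p = w"
    by (rule field_extension[OF p assms(3)])
  obtain Z' where f4: "vf U Z'" "Z' p = w'"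
    by (rule field_extension[OF p assms(4)])
  note f = f1 f2 f3 f4
  note c = vf_cscale[OF U f(5), of a] vf_cscale[OF U f(7), of b]
  show ?thesis
    using curvature_at_eq[OF p U p f(1,3) vf_add[OF c]] curvature_at_eq[OF p U p f(1,3,5)]
      curvature_at_eq[OF p U p f(1,3,7)] curvature_add3[OF U f(1,3) c(1) p c(2)]
      curvature_scale3[OF U f(1,3,5) p smooth_fun_const[OF atlas U]]
      curvature_scale3[OF U f(1,3,7) p smooth_fun_const[OF atlas U]]
    by (simp add: f)
qed

lemma ricci_frame:
  assumes "v \<in> T p" "w \<in> T p"
  shows "ricci A nab p v w = (\<Sum>i\<in>I. g p (curvature_at A nab p (G i p) v w) (G i p))"
  unfolding ricci_def
  by (rule trace_on_orthonormal[OF I])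
    (use p assms in \<open>auto simp: G_T orthonormal spanning curvature_at_lin1 curvature_at_T\<close>)

lemma scalar_curvature_frame:
  "scalar_curvature A g nab p =
    (\<Sum>j\<in>I. \<Sum>i\<in>I. g p (curvature_at A nab p (G i p) (G j p) (G j p)) (G i p))"
proof -
  let ?P = "\<lambda>E. finite E \<and> span E = T p \<and> (\<forall>u\<in>E. \<forall>v\<in>E. g p u v = (if u = v then 1 else 0))"
  define E where "E = (SOME E. ?P E)"
  \<comment> \<open>The frame itself is an orthonormal basis of \<open>T p\<close>, so the choice
    that defines \<open>E\<close> does return one.\<close>
  have "?P ((\<lambda>i. G i p) ` I)"
  proof (intro conjI ballI)
    show "span ((\<lambda>i. G i p) ` I) = T p"
      using spanning[OF p] G_T[OF p]
      by (intro antisym span_minimal subspace_tangent_space[OF atlas]) auto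
    fix u v assume "u \<in> (\<lambda>i. G i p) ` I" "v \<in> (\<lambda>i. G i p) ` I"
    then obtain i j where ij: "i \<in> I" "j \<in> I" "u = G i p" "v = G j p" by blast
    \<comment> \<open>\<open>?P\<close> compares vectors while the frame compares indices: equal
      vectors have inner product 1, so distinct indices give distinct vectors.\<close>
    show "g p u v = (if u = v then 1 else 0)"
      using orthonormal[OF p ij(1,2)] orthonormal[OF p ij(1,1)] ij by (auto split: if_splits)
  qed (use I in simp)
  then have E: "?P E"
    unfolding E_def by (rule someI)
  have ET: "b \<in> T p" if "b \<in> E" for b
    using that E span_base[of b E] by simp
  have "scalar_curvature A g nab p = (\<Sum>b\<in>E. ricci A nab p b b)"
    unfolding scalar_curvature_def Let_def E_def ..
  also have "\<dots> = (\<Sum>i\<in>I. ricci A nab p (G i p) (G i p))"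
  proof (rule bilinear_trace_orthonormal[OF I, where H = "ricci A nab p"])
    fix x y z :: "'a tvec" and a b :: real
    assume t: "x \<in> T p" "y \<in> T p" "z \<in> T p"
    show "ricci A nab p (a *\<^sub>R x + b *\<^sub>R y) z = a * ricci A nab p x z + b * ricci A nab p y z"
      "ricci A nab p z (a *\<^sub>R x + b *\<^sub>R y) = a * ricci A nab p z x + b * ricci A nab p z y"
      using t p by (simp_all add: ricci_frame T_add T_scale curvature_at_lin2 curvature_at_lin3
          g_lin G_T curvature_at_T sum.distrib sum_distrib_left)
  qed (use p E in \<open>auto simp: G_T orthonormal spanning\<close>)
  finally show ?thesis
    by (simp add: ricci_frame G_T p)
qed

end

end

section \<open>Orthogonal splittings\<close>

text \<open>The map is abstracted away here: \<open>D\<close> stands for the range distribution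
  extended over the target, with frames \<open>E\<close> of \<open>D\<close> and \<open>e\<close> of
  its complement.\<close>

locale split_framed = riemannian_manifold A g nab
  for A :: "('a::{t2_space,second_countable_topology}, 'e::euclidean_space) atlas" and g nab +
  fixes U :: "'a set" and D :: "'a \<Rightarrow> 'a tvec set" and J K :: "nat set" and E e :: "nat \<Rightarrow> 'a vfield"
  assumes open_U: "open U" and finite_J: "finite J" and finite_K: "finite K"
    and E_frame: "orthonormal_frame A g U D J E"
    and e_frame: "orthonormal_frame A g U (perp A g D) K e"
begin

lemma E_vf: "j \<in> J \<Longrightarrow> vf U (E j)" and e_vf: "k \<in> K \<Longrightarrow> vf U (e k)"
  using E_frame e_frame by (auto simp: orthonormal_frame_def)

lemma E_T: "p \<in> U \<Longrightarrow> j \<in> J \<Longrightarrow> E j p \<in> T p" and e_T: "p \<in> U \<Longrightarrow> k \<in> K \<Longrightarrow> e k p \<in> T p"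
  using vector_field_tangent E_vf e_vf by blast+

lemma E_orthonormal: "p \<in> U \<Longrightarrow> i \<in> J \<Longrightarrow> j \<in> J \<Longrightarrow> g p (E i p) (E j p) = (if i = j then 1 else 0)"
  and D_eq: "p \<in> U \<Longrightarrow> D p = span ((\<lambda>j. E j p) ` J)"
  using E_frame by (auto simp: orthonormal_frame_def)

lemma e_orthonormal: "p \<in> U \<Longrightarrow> i \<in> K \<Longrightarrow> j \<in> K \<Longrightarrow> g p (e i p) (e j p) = (if i = j then 1 else 0)"
  and perp_eq: "p \<in> U \<Longrightarrow> perp A g D p = span ((\<lambda>k. e k p) ` K)"
  using e_frame by (auto simp: orthonormal_frame_def)

lemma E_in_D: "p \<in> U \<Longrightarrow> j \<in> J \<Longrightarrow> E j p \<in> D p"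
  by (simp add: D_eq span_base)

lemma e_in_perp: "p \<in> U \<Longrightarrow> k \<in> K \<Longrightarrow> e k p \<in> perp A g D p"
  by (simp add: perp_eq span_base)

lemma D_expansion:
  assumes "p \<in> U" "x \<in> D p"
  shows "x \<in> T p" "x = (\<Sum>j\<in>J. g p x (E j p) *\<^sub>R E j p)"
  using orthonormal_expansion[OF finite_J, of "\<lambda>j. E j p" p x] assms
  by (auto simp: E_T E_orthonormal D_eq)

lemma perp_orthogonal: "v \<in> perp A g D p \<Longrightarrow> x \<in> D p \<Longrightarrow> g p v x = 0"
  and perp_T: "v \<in> perp A g D p \<Longrightarrow> v \<in> T p"
  by (auto simp: perp_def orth_compl_def)

lemma perpI:
  assumes p: "p \<in> U" and v: "v \<in> T p" and 0: "\<And>j. j \<in> J \<Longrightarrow> g p v (E j p) = 0"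
  shows "v \<in> perp A g D p"
  unfolding perp_def orth_compl_def
proof (safe)
  fix x assume x: "x \<in> D p"
  have "g p v x = g p x v"
    using g_sym v D_expansion(1)[OF p x] by blast
  also have "\<dots> = g p (\<Sum>j\<in>J. g p x (E j p) *\<^sub>R E j p) v"
    using D_expansion(2)[OF p x] by (rule arg_cong)
  also have "\<dots> = (\<Sum>j\<in>J. g p x (E j p) * g p (E j p) v)"
    by (rule g_sum_scale) (use E_T p v in auto)
  also have "\<dots> = 0"
    using 0 g_sym[OF v E_T[OF p]] by simp
  finally show "g p v x = 0" .
qed (rule v)

text \<open>The frame sum meets both conditions in the description of \<open>tan_part\<close>. Any
  other candidate differs from \<open>v\<close> by a vector orthogonal to \<open>D p\<close>, so it
  has the same frame coefficients.\<close>

lemma tan_part_eq: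
  assumes p: "p \<in> U" and v: "v \<in> T p"
  shows "tan_part A g D p v = (\<Sum>j\<in>J. g p v (E j p) *\<^sub>R E j p)" (is "_ = ?t")
    and tan_part_in_D: "tan_part A g D p v \<in> D p"
    and perp_part_in_perp: "v - tan_part A g D p v \<in> perp A g D p"
proof -
  have tD: "?t \<in> D p"
    unfolding D_eq[OF p] by (intro span_sum span_scale span_base) auto
  have tperp: "v - ?t \<in> perp A g D p"
  proof (rule perpI[OF p])
    show "v - ?t \<in> T p"
      using v D_expansion(1)[OF p tD] by (rule T_diff)
    fix i assume i: "i \<in> J"
    have "g p ?t (E i p) = (\<Sum>j\<in>J. g p v (E j p) * g p (E j p) (E i p))"
      by (rule g_sum_scale) (use E_T p i in auto)
    also have "\<dots> = g p v (E i p)"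
      using finite_J i p by (simp add: E_orthonormal if_distrib[of "\<lambda>c. _ * c"] cong: if_cong)
    finally show "g p (v - ?t) (E i p) = 0"
      using g_diff[OF v D_expansion(1)[OF p tD] E_T[OF p i]] by simp
  qed
  show eq: "tan_part A g D p v = ?t"
    unfolding tan_part_def
  proof (rule the_equality)
    fix w assume w: "w \<in> D p \<and> v - w \<in> perp A g D p"
    have wT: "w \<in> T p"
      using D_expansion(1)[OF p] w by blast
    have "g p w (E j p) = g p v (E j p)" if j: "j \<in> J" for j
      using perp_orthogonal[of "v - w" p "E j p"] w E_in_D[OF p j] g_diff[OF v wT E_T[OF p j]] by simp
    then show "w = ?t"
      by (intro trans[OF D_expansion(2)[OF p conjunct1[OF w]]] sum.cong) auto
  qed (use tD tperp in simp)
  show "tan_part A g D p v \<in> D p" "v - tan_part A g D p v \<in> perp A g D p"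
    using tD tperp by (simp_all only: eq)
qed

lemma E_e_orthogonal: "p \<in> U \<Longrightarrow> j \<in> J \<Longrightarrow> k \<in> K \<Longrightarrow> g p (E j p) (e k p) = 0"
  and e_E_orthogonal: "p \<in> U \<Longrightarrow> j \<in> J \<Longrightarrow> k \<in> K \<Longrightarrow> g p (e k p) (E j p) = 0"
  using perp_orthogonal[OF e_in_perp E_in_D] g_sym[OF E_T e_T] by auto

text \<open>The joined frame spans because each tangent vector is its part in \<open>D p\<close>
  plus a remainder in the complement. The disjoint sum \<open>J <+> K\<close> keeps apart the index
  sets, which may overlap as sets of naturals.\<close>

sublocale full: orthonormal_framed A g nab U "J <+> K" "case_sum E e"
proof
  show "T p \<subseteq> span ((\<lambda>i. case_sum E e i p) ` (J <+> K))" if p: "p \<in> U" for p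
  proof
    fix v assume v: "v \<in> T p"
    let ?S = "span ((\<lambda>i. case_sum E e i p) ` (J <+> K))"
    have "D p \<subseteq> ?S" "perp A g D p \<subseteq> ?S"
      unfolding D_eq[OF p] perp_eq[OF p] by (rule span_mono, force)+
    then have "tan_part A g D p v + (v - tan_part A g D p v) \<in> ?S"
      using tan_part_in_D[OF p v] perp_part_in_perp[OF p v] by (intro span_add) auto
    then show "v \<in> ?S" by simp
  qed
qed (auto simp: open_U finite_J finite_K E_vf e_vf E_orthonormal e_orthonormal
      E_e_orthogonal e_E_orthogonal split: if_splits)

text \<open>In the joined frame, a vector orthogonal to all \<open>e k\<close> has components along
  the \<open>E j\<close> alone; so \<open>D\<close> is the complement of its complement.\<close>

lemma D_memberI:
  assumes p: "p \<in> U" and v: "v \<in> T p" and 0: "\<And>k. k \<in> K \<Longrightarrow> g p v (e k p) = 0"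
  shows "v \<in> D p"
proof -
  have "v = (\<Sum>i\<in>J <+> K. g p v (case_sum E e i p) *\<^sub>R case_sum E e i p)"
    by (rule full.frame_expansion[OF p v])
  also have "\<dots> = (\<Sum>j\<in>J. g p v (E j p) *\<^sub>R E j p)"
    by (simp add: sum.Plus[OF finite_J finite_K] 0)
  also have "\<dots> \<in> D p"
    unfolding D_eq[OF p] by (intro span_sum span_scale span_base) auto
  finally show ?thesis .
qed

text \<open>Meant for inner products of frame fields, which are constant on \<open>U\<close>;
  differentiating them moves a covariant derivative from one factor to the other.\<close>

lemma derivative_const:
  assumes "vf U X" "p \<in> U" "\<And>q. q \<in> U \<Longrightarrow> h q = c"
  shows "X p h = 0"
proof -
  note t = vector_field_tangent[OF assms(1,2)]
  have "X p h = X p (\<lambda>q. c)"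
    by (rule tangent_cong[OF t atlas open_U assms(2,3)])
  then show ?thesis
    using tangent_const[OF t atlas] by simp
qed

lemma tan_vf:
  assumes X: "vf U X"
  shows "vf U (\<lambda>p. tan_part A g D p (X p))"
proof (rule vector_field_cong[OF atlas])
  show "vf U (\<Sum>j\<in>J. (\<lambda>p. g p (X p) (E j p) *\<^sub>R E j p))"
    by (intro vector_field_sum[OF atlas] vf_scale g_smooth open_U X E_vf)
  show "(\<Sum>j\<in>J. (\<lambda>p. g p (X p) (E j p) *\<^sub>R E j p)) p = tan_part A g D p (X p)" if "p \<in> U" for p
    by (simp only: sum_fun_apply[where x = p] tan_part_eq[OF that vector_field_tangent[OF X that]])
qed

context
  fixes X V
  assumes X: "vf U X" and V: "vf U V"
begin

lemma shape_vf: "vf U (shape A g nab D V X)"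
  by (rule vector_field_cong[OF atlas _ vf_cscale[OF open_U tan_vf[OF nab_vf[OF open_U X V]], of "-1"]])
    (simp add: shape_def)

lemma perp_conn_vf: "vf U (perp_conn A g nab D X V)"
  by (rule vector_field_cong[OF atlas _ vf_diff[OF open_U nab_vf[OF open_U X V] tan_vf[OF nab_vf[OF open_U X V]]]])
    (simp add: perp_conn_def perp_part_def)

lemma nab_decomposition: "nab X V p = perp_conn A g nab D X V p - shape A g nab D V X p"
  by (simp add: perp_conn_def perp_part_def shape_def)

context
  fixes p assumes p: "p \<in> U"
begin

lemma shape_in_D: "shape A g nab D V X p \<in> D p"
  using tan_part_in_D[OF p vector_field_tangent[OF nab_vf[OF open_U X V] p]]
  by (simp add: shape_def D_eq[OF p] span_neg)

lemma perp_conn_in_perp: "perp_conn A g nab D X V p \<in> perp A g D p"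
  using perp_part_in_perp[OF p vector_field_tangent[OF nab_vf[OF open_U X V] p]]
  by (simp add: perp_conn_def perp_part_def)

text \<open>Pairing with a vector of \<open>D p\<close> removes the complementary part in
  \<open>nab_decomposition\<close>.\<close>

lemma shape_inner:
  assumes x: "x \<in> D p"
  shows "g p (nab X V p) x = - g p (shape A g nab D V X p) x"
  using g_diff[OF perp_T[OF perp_conn_in_perp] D_expansion(1)[OF p shape_in_D] D_expansion(1)[OF p x]]
    perp_orthogonal[OF perp_conn_in_perp x]
  by (simp add: nab_decomposition)

end

end

section \<open>Mixed curvature and scalar curvature when the complement is totally geodesic\<close>

context
  assumes tot_geo: "perp_totally_geodesic A g nab D"
begin

lemma nab_perp:
  assumes X: "vf U X" "\<And>q. q \<in> U \<Longrightarrow> X q \<in> perp A g D q"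
    and V: "vf U V" "\<And>q. q \<in> U \<Longrightarrow> V q \<in> perp A g D q" and p: "p \<in> U"
  shows "nab X V p = perp_conn A g nab D X V p" "x \<in> D p \<Longrightarrow> g p (nab X V p) x = 0"
proof -
  show *: "nab X V p = perp_conn A g nab D X V p"
    using tot_geo open_U X V p unfolding perp_totally_geodesic_def section_of_def by blast
  show "g p (nab X V p) x = 0" if "x \<in> D p"
    using perp_orthogonal[OF perp_conn_in_perp[OF X(1) V(1) p] that] by (simp add: *)
qed

text \<open>Differentiating \<open>g q (E j q) (e l q) = 0\<close> along \<open>e k\<close> trades
  the derivative of \<open>E j\<close> for that of \<open>e l\<close>, which stays in the complement
  by total geodesy.\<close>

lemma nab_e_E_in_D:
  assumes j: "j \<in> J" and k: "k \<in> K" and p: "p \<in> U"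
  shows "nab (e k) (E j) p \<in> D p"
proof (rule D_memberI[OF p vector_field_tangent[OF nab_vf[OF open_U e_vf[OF k] E_vf[OF j]] p]])
  fix l assume l: "l \<in> K"
  have "e k p (\<lambda>q. g q (E j q) (e l q)) = 0"
    by (rule derivative_const[OF e_vf[OF k] p]) (use E_e_orthogonal j l in auto)
  moreover have "g p (E j p) (nab (e k) (e l) p) = 0"
    using nab_perp(2)[OF e_vf[OF k] e_in_perp[OF _ k] e_vf[OF l] e_in_perp[OF _ l] p E_in_D[OF p j]]
      g_sym[OF E_T[OF p j] vector_field_tangent[OF nab_vf[OF open_U e_vf[OF k] e_vf[OF l]] p]] by simp
  ultimately show "g p (nab (e k) (E j) p) (e l p) = 0"
    using nab_metric[OF open_U E_vf[OF j] e_vf[OF l] e_vf[OF k] p] by simp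
qed

context
  fixes p
  assumes p: "p \<in> U"
    and integrable: "\<And>i j k. i \<in> J \<Longrightarrow> j \<in> J \<Longrightarrow> k \<in> K \<Longrightarrow> g p (e k p) (lie_bracket A (E i) (E j) p) = 0"
begin

text \<open>Differentiating \<open>g q (e k q) (E j q) = 0\<close> along \<open>E i\<close> turns
  the two sides into minus the \<open>e k\<close> components of \<open>nab (E i) (E j)\<close> and
  \<open>nab (E j) (E i)\<close>. By torsion-freeness these differ by that of the bracket, which
  vanishes at \<open>p\<close> by \<open>integrable\<close>.\<close>

lemma nab_E_e_symmetric:
  assumes i: "i \<in> J" and j: "j \<in> J" and k: "k \<in> K"
  shows "g p (nab (E i) (e k) p) (E j p) = g p (nab (E j) (e k) p) (E i p)"
proof -
  have *: "g p (nab (E i) (e k) p) (E j p) = - g p (e k p) (nab (E i) (E j) p)"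
    if i: "i \<in> J" and j: "j \<in> J" for i j
  proof -
    have "E i p (\<lambda>q. g q (e k q) (E j q)) = 0"
      by (rule derivative_const[OF E_vf[OF i] p]) (use e_E_orthogonal j k in auto)
    then show ?thesis
      using nab_metric[OF open_U e_vf[OF k] E_vf[OF j] E_vf[OF i] p] by simp
  qed
  have t: "nab (E i) (E j) p \<in> T p" "nab (E j) (E i) p \<in> T p" "e k p \<in> T p"
    using i j k p E_vf e_vf by (auto intro!: vector_field_tangent[OF _ p] nab_vf open_U)
  have "g p (e k p) (nab (E i) (E j) p - nab (E j) (E i) p) = 0"
    using integrable[OF i j k] lie_bracket_nab[OF open_U E_vf[OF i] E_vf[OF j] p] by simp
  then have "g p (e k p) (nab (E i) (E j) p) = g p (e k p) (nab (E j) (E i) p)"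
    using t by (simp add: g_sym[of "e k p"] g_diff T_diff)
  then show ?thesis
    using *[OF i j] *[OF j i] by simp
qed

text \<open>As \<open>nab\<close> is tensorial in its first slot, only the frame components of
  \<open>B p\<close> enter, and those along \<open>e\<close> vanish. This extends the symmetry from
  the frame to any field whose value at \<open>p\<close> lies in \<open>D p\<close>.\<close>

lemma shape_symmetric:
  assumes B: "vf U B" "B p \<in> D p" and j: "j \<in> J" and k: "k \<in> K"
  shows "g p (nab B (e k) p) (E j p) = - g p (shape A g nab D (e k) (E j) p) (B p)"
proof -
  let ?n = "nab (E j) (e k) p"
  have nT: "nab (E i) (e k) p \<in> T p" if "i \<in> J" for i
    by (rule vector_field_tangent[OF nab_vf[OF open_U E_vf[OF that] e_vf[OF k]] p])
  note BT = D_expansion(1)[OF p B(2)]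
  have 0: "g p (B p) (e l p) = 0" if "l \<in> K" for l
    using perp_orthogonal[OF e_in_perp[OF p that] B(2)] g_sym[OF BT e_T[OF p that]] by simp
  have "nab B (e k) p = (\<Sum>i\<in>J. g p (B p) (E i p) *\<^sub>R nab (E i) (e k) p)"
    using full.nab_expansion[OF B(1) e_vf[OF k] p] by (simp add: sum.Plus[OF finite_J finite_K] 0)
  then have "g p (nab B (e k) p) (E j p) = (\<Sum>i\<in>J. g p (B p) (E i p) * g p (nab (E i) (e k) p) (E j p))"
    using nT E_T[OF p j] by (simp add: g_sum_scale)
  also have "\<dots> = (\<Sum>i\<in>J. g p (B p) (E i p) * g p (E i p) ?n)"
    using nab_E_e_symmetric[OF _ j k] g_sym[OF nT[OF j] E_T[OF p]] by simp
  also have "\<dots> = g p (\<Sum>i\<in>J. g p (B p) (E i p) *\<^sub>R E i p) ?n"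
    by (rule g_sum_scale[symmetric]) (use E_T p nT j in auto)
  also have "\<dots> = g p (B p) ?n"
    by (rule arg_cong[OF D_expansion(2)[OF p B(2), symmetric]])
  also have "\<dots> = - g p (shape A g nab D (e k) (E j) p) (B p)"
    using g_sym[OF BT nT[OF j]] shape_inner[OF E_vf[OF j] e_vf[OF k] p B(2)] by simp
  finally show ?thesis .
qed

lemma mixed_curvature:
  assumes j: "j \<in> J" and k: "k \<in> K"
  defines "S \<equiv> shape A g nab D (e k) (E j)" and "B \<equiv> nab (e k) (E j)"
  shows "g p (curvature A nab (E j) (e k) (e k) p) (E j p) =
    - g p (shape A g nab D (perp_conn A g nab D (e k) (e k)) (E j) p) (E j p)
    + g p (nab (e k) S p) (E j p) - g p (S p) (S p) - g p (B p) (S p)"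
proof -
  note Ej = E_vf[OF j] and ek = e_vf[OF k]
  note EjT = E_T[OF p j] and EjD = E_in_D[OF p j]
  define V where "V = perp_conn A g nab D (e k) (e k)"
  define P where "P = perp_conn A g nab D (E j) (e k)"
  have V: "vf U V" and P: "vf U P" and S: "vf U S" and B: "vf U B"
    unfolding V_def P_def S_def B_def
    by (intro perp_conn_vf shape_vf nab_vf open_U Ej ek)+
  have PS: "vf U (\<lambda>q. P q - S q)"
    by (rule vf_diff[OF open_U P S])
  have n: "nab (E j) (e k) q = P q - S q" for q
    unfolding P_def S_def by (rule nab_decomposition[OF Ej ek])
  have T: "X p \<in> T p" if "vf U X" for X
    using vector_field_tangent that p by blast
  \<comment> \<open>First term: by total geodesy \<open>nab (e k) (e k)\<close> equals
    \<open>V\<close> on all of \<open>U\<close>, so the replacement is legitimate under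
    \<open>nab (E j)\<close>.\<close>
  have "nab (E j) (nab (e k) (e k)) p = nab (E j) V p"
    by (rule nab_cong[OF open_U Ej V _ _ p])
      (auto simp: V_def intro: nab_perp ek e_in_perp k)
  then have 1: "g p (nab (E j) (nab (e k) (e k)) p) (E j p) = - g p (shape A g nab D V (E j) p) (E j p)"
    using shape_inner[OF Ej V p EjD] by simp
  \<comment> \<open>Second term: \<open>P\<close> is a section of the complement, so its derivative
    along \<open>e k\<close> stays there and only \<open>S\<close> survives the pairing.\<close>
  have "g p (nab (e k) P p) (E j p) = 0"
    by (rule nab_perp(2)[OF ek e_in_perp[OF _ k] P _ p EjD])
      (auto simp: P_def intro: perp_conn_in_perp Ej ek)
  moreover have "nab (e k) (nab (E j) (e k)) p = nab (e k) P p - nab (e k) S p"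
    using nab_diff2[OF open_U P S ek p] nab_cong[OF open_U ek PS _ n p, of "e k"] by simp
  ultimately have 2: "g p (nab (e k) (nab (E j) (e k)) p) (E j p) = - g p (nab (e k) S p) (E j p)"
    using g_diff[OF T T EjT, of "nab (e k) P" "nab (e k) S"] nab_vf[OF open_U ek] P S by simp
  \<comment> \<open>Third term: torsion-freeness writes the bracket as \<open>P - S - B\<close>. The
    part \<open>P\<close> contributes nothing by total geodesy, while \<open>S\<close> and
    \<open>B\<close> have values in \<open>D p\<close> at \<open>p\<close>, where
    \<open>shape_symmetric\<close> turns them into products with \<open>S p\<close>.\<close>
  have "nab (lie_bracket A (E j) (e k)) (e k) p = nab (\<lambda>q. (P q - S q) - B q) (e k) p"
    by (rule nab_cong[OF open_U vf_diff[OF open_U PS B] ek _ _ p])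
      (simp_all add: lie_bracket_nab[OF open_U Ej ek] n B_def)
  then have "nab (lie_bracket A (E j) (e k)) (e k) p = (nab P (e k) p - nab S (e k) p) - nab B (e k) p"
    using nab_diff1[OF open_U PS B ek p] nab_diff1[OF open_U P S ek p] by simp
  then have "g p (nab (lie_bracket A (E j) (e k)) (e k) p) (E j p) =
      g p (nab P (e k) p) (E j p) - g p (nab S (e k) p) (E j p) - g p (nab B (e k) p) (E j p)"
    using nab_vf[OF open_U P ek] nab_vf[OF open_U S ek] nab_vf[OF open_U B ek] EjT
    by (simp add: g_diff T_diff T)
  moreover have "g p (nab P (e k) p) (E j p) = 0"
    by (rule nab_perp(2)[OF P _ ek e_in_perp[OF _ k] p EjD])
      (auto simp: P_def intro: perp_conn_in_perp Ej ek)
  moreover have "g p (nab S (e k) p) (E j p) = - g p (S p) (S p)"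
    using shape_symmetric[OF S _ j k] shape_in_D[OF Ej ek p] by (simp add: S_def)
  moreover have "g p (nab B (e k) p) (E j p) = - g p (B p) (S p)"
    using shape_symmetric[OF B _ j k] nab_e_E_in_D[OF j k p] g_sym[OF T[OF B] T[OF S]]
    by (simp add: S_def B_def)
  ultimately have 3: "g p (nab (lie_bracket A (E j) (e k)) (e k) p) (E j p) = g p (S p) (S p) + g p (B p) (S p)"
    by simp
  have "nab (E j) (nab (e k) (e k)) p \<in> T p" "nab (e k) (nab (E j) (e k)) p \<in> T p"
    "nab (lie_bracket A (E j) (e k)) (e k) p \<in> T p"
    by (intro T nab_vf lie_bracket_vf open_U Ej ek)+
  then show ?thesis
    using 1 2 3 EjT by (simp add: curvature_def g_diff T_diff V_def)
qed

text \<open>The double sum over \<open>J <+> K\<close> falls into four blocks: two partial scalar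
  curvatures and two mixed blocks. The mixed blocks agree by skewness of the curvature in its first
  two and last two arguments, hence the factor 2.\<close>

lemma scalar_curvature_split:
  "scalar_curvature A g nab p = frame_scalar A g nab J E p + frame_scalar A g nab K e p
    + 2 * (\<Sum>j\<in>J. \<Sum>k\<in>K. g p (curvature A nab (E j) (e k) (e k) p) (E j p))"
proof -
  let ?R = "\<lambda>X Y. g p (curvature_at A nab p (X p) (Y p) (Y p)) (X p)"
  have "?R (E j) (e k) = g p (curvature A nab (E j) (e k) (e k) p) (E j p)"
    "?R (e k) (E j) = g p (curvature A nab (E j) (e k) (e k) p) (E j p)"
    if j: "j \<in> J" and k: "k \<in> K" for j k
  proof -
    note Ej = E_vf[OF j] and ek = e_vf[OF k]
    show "?R (E j) (e k) = g p (curvature A nab (E j) (e k) (e k) p) (E j p)"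
      by (simp add: full.curvature_at_eq[OF p open_U p Ej ek ek])
    have "?R (e k) (E j) = g p (curvature A nab (e k) (E j) (E j) p) (e k p)"
      by (simp add: full.curvature_at_eq[OF p open_U p ek Ej Ej])
    also have "\<dots> = - g p (curvature A nab (e k) (E j) (e k) p) (E j p)"
      by (rule curvature_skew[OF open_U ek Ej Ej p ek])
    also have "\<dots> = g p (curvature A nab (E j) (e k) (e k) p) (E j p)"
      using curvature_anti[OF open_U ek Ej ek p] E_T[OF p j]
        g_minus[OF vector_field_tangent[OF curvature_vf[OF open_U Ej ek ek] p]] by simp
    finally show "?R (e k) (E j) = \<dots>" .
  qed
  then have cross: "(\<Sum>j\<in>J. \<Sum>k\<in>K. ?R (e k) (E j)) = (\<Sum>j\<in>J. \<Sum>k\<in>K. g p (curvature A nab (E j) (e k) (e k) p) (E j p))"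
    "(\<Sum>k\<in>K. \<Sum>j\<in>J. ?R (E j) (e k)) = (\<Sum>j\<in>J. \<Sum>k\<in>K. g p (curvature A nab (E j) (e k) (e k) p) (E j p))"
    by (simp_all add: sum.swap[of _ J K])
  show ?thesis
    using cross
    by (simp add: full.scalar_curvature_frame[OF p] sum.Plus[OF finite_J finite_K] sum.distrib
        frame_scalar_def frame_ricci_def)
qed

text \<open>Twice the mixed curvature contains two copies of the pairing of
  \<open>nab (e k) (?S j k)\<close> with \<open>E j\<close>. By metric compatibility one copy
  becomes the derivative along \<open>e k\<close> of the product of \<open>?S j k\<close> and
  \<open>E j\<close>, minus the product of \<open>nab (e k) (E j)\<close> and \<open>?S j k\<close>;
  this raises the coefficient of the latter from -2 to -3 in absolute value.\<close>

lemma scalar_curvature_shape: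
  "scalar_curvature A g nab p =
      frame_scalar A g nab J E p + frame_scalar A g nab K e p
    - 2 * (\<Sum>j\<in>J. \<Sum>k\<in>K. g p (shape A g nab D (perp_conn A g nab D (e k) (e k)) (E j) p) (E j p))
    + (\<Sum>j\<in>J. \<Sum>k\<in>K. g p (nab (e k) (shape A g nab D (e k) (E j)) p) (E j p))
    - 2 * (\<Sum>j\<in>J. \<Sum>k\<in>K. g p (shape A g nab D (e k) (E j) p) (shape A g nab D (e k) (E j) p))
    - 3 * (\<Sum>j\<in>J. \<Sum>k\<in>K. g p (nab (e k) (E j) p) (shape A g nab D (e k) (E j) p))
    + (\<Sum>j\<in>J. \<Sum>k\<in>K. e k p (\<lambda>q. g q (shape A g nab D (e k) (E j) q) (E j q)))"
proof -
  let ?S = "\<lambda>j k. shape A g nab D (e k) (E j)"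
  have *: "2 * g p (curvature A nab (E j) (e k) (e k) p) (E j p) =
      - 2 * g p (shape A g nab D (perp_conn A g nab D (e k) (e k)) (E j) p) (E j p)
      + g p (nab (e k) (?S j k) p) (E j p) - 2 * g p (?S j k p) (?S j k p)
      - 3 * g p (nab (e k) (E j) p) (?S j k p) + e k p (\<lambda>q. g q (?S j k q) (E j q))"
    if j: "j \<in> J" and k: "k \<in> K" for j k
  proof -
    note Ej = E_vf[OF j] and ek = e_vf[OF k]
    have "g p (?S j k p) (nab (e k) (E j) p) = g p (nab (e k) (E j) p) (?S j k p)"
      by (intro g_sym vector_field_tangent[OF _ p] shape_vf nab_vf open_U Ej ek)
    then show ?thesis
      using mixed_curvature[OF j k] nab_metric[OF open_U shape_vf[OF Ej ek] Ej ek p] by simp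
  qed
  have "2 * (\<Sum>j\<in>J. \<Sum>k\<in>K. g p (curvature A nab (E j) (e k) (e k) p) (E j p)) =
     (\<Sum>j\<in>J. \<Sum>k\<in>K. 2 * g p (curvature A nab (E j) (e k) (e k) p) (E j p))"
    by (simp add: sum_distrib_left)
  then show ?thesis
    by (simp add: scalar_curvature_split * sum.distrib sum_subtractf sum_negf sum_distrib_left)
qed

end

end

end

text \<open>\<open>D\<close> extends the range distribution from the image of \<open>F\<close> to
  the whole target, and each \<open>FX j\<close> is a field on the target that is
  \<open>F\<close>-related to \<open>X j\<close>. This relation supplies the vanishing normal
  component of the brackets at \<open>F p\<close>, which is the condition
  \<open>integrable\<close>.\<close>

theorem theorem3p4:
  fixes AM :: "('a::{t2_space,second_countable_topology}, 'e::euclidean_space) atlas"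
    and AN :: "('b::{t2_space,second_countable_topology}, 'f::euclidean_space) atlas"
    and gM :: "'a metric" and gN :: "'b metric"
    and nab :: "'b vfield \<Rightarrow> 'b vfield \<Rightarrow> 'b vfield"
    and F :: "'a \<Rightarrow> 'b"
    and D :: "'b \<Rightarrow> 'b tvec set"
    and m r n1 :: nat
    and W :: "'a set" and U :: "'b set"
    and X :: "nat \<Rightarrow> 'a vfield" and FX e :: "nat \<Rightarrow> 'b vfield"
    and p :: 'a
  assumes M: "smooth_atlas AM" "riemannian_metric AM gM" "DIM('e) = m"
    and N: "smooth_atlas AN" "riemannian_metric AN gN"
    and nab: "levi_civita AN gN nab"
    and F: "riemannian_map AM gM AN gN F"
    and r: "\<And>x. dim (ker_diff AM AN F x) = r"
    and D: "distribution AN (m - r) D" "\<And>x. D (F x) = range_diff AM AN F x"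
    and tot_geo: "perp_totally_geodesic AN gN nab D"
    and WU: "open W" "p \<in> W" "open U" "F ` W \<subseteq> U"
    and X: "\<And>j. j \<in> {r+1..m} \<Longrightarrow> section_of AM W (horizontal AM gM AN F) (X j)"
    and FX: "\<And>j x. j \<in> {r+1..m} \<Longrightarrow> x \<in> W \<Longrightarrow> FX j (F x) = differential AN F x (X j x)"
    and FX_frame: "orthonormal_frame AN gN U D {r+1..m} FX"
    and e_frame: "orthonormal_frame AN gN U (perp AN gN D) {1..n1} e"
  shows "scalar_curvature AN gN nab (F p) =
      frame_scalar AN gN nab {r+1..m} FX (F p)
    + frame_scalar AN gN nab {1..n1} e (F p)
    - 2 * (\<Sum>j=r+1..m. \<Sum>k=1..n1.
        gN (F p) (shape AN gN nab D (perp_conn AN gN nab D (e k) (e k)) (FX j) (F p)) (FX j (F p)))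
    + (\<Sum>j=r+1..m. \<Sum>k=1..n1.
        gN (F p) (nab (e k) (shape AN gN nab D (e k) (FX j)) (F p)) (FX j (F p)))
    - 2 * (\<Sum>j=r+1..m. \<Sum>k=1..n1.
        gN (F p) (shape AN gN nab D (e k) (FX j) (F p)) (shape AN gN nab D (e k) (FX j) (F p)))
    - 3 * (\<Sum>j=r+1..m. \<Sum>k=1..n1.
        gN (F p) (nab (e k) (FX j) (F p)) (shape AN gN nab D (e k) (FX j) (F p)))
    + (\<Sum>j=r+1..m. \<Sum>k=1..n1.
        e k (F p) (\<lambda>y. gN y (shape AN gN nab D (e k) (FX j) y) (FX j y)))"
proof -
  interpret split_framed AN gN nab U D "{r+1..m}" "{1..n1}" FX e
    using N nab WU(3) FX_frame e_frame by unfold_locales auto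
  have Fp: "F p \<in> U"
    using WU by auto
  have "smooth_map AM AN F"
    using F by (simp add: riemannian_map_def)
  have Xv: "vector_field AM W (X j)" if "j \<in> {r+1..m}" for j
    using X[OF that] by (simp add: section_of_def)
  have "gN (F p) (e k (F p)) (lie_bracket AN (FX i) (FX j) (F p)) = 0"
    if i: "i \<in> {r+1..m}" and j: "j \<in> {r+1..m}" and k: "k \<in> {1..n1}" for i j k
  proof -
    have "lie_bracket AN (FX i) (FX j) (F p) = differential AN F p (lie_bracket AM (X i) (X j) p)"
      by (rule lie_bracket_related[OF M(1) N(1) \<open>smooth_map AM AN F\<close> WU
            Xv[OF i] Xv[OF j] E_vf[OF i] E_vf[OF j] FX[OF i] FX[OF j]])
    \<comment> \<open>\<open>D (F p)\<close> is the range of the differential at \<open>p\<close>,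
      and the bracket upstairs is a tangent vector at \<open>p\<close>.\<close>
    also have "\<dots> \<in> D (F p)"
      unfolding D(2) range_diff_def
      by (intro imageI lie_bracket_tangent[OF M(1) WU(1,2) Xv[OF i] Xv[OF j]])
    finally show ?thesis
      by (rule perp_orthogonal[OF e_in_perp[OF Fp k]])
  qed
  then show ?thesis
    by (rule scalar_curvature_shape[OF tot_geo Fp])
qed

end
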